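(* Let $X$ be a set and let $r\colon X\times X\to X\times X$, $r(x,y)=(\sigma_x(y),\tau_y(x))$, be a non-degenerate solution of the Yang--Baxter equation. Let $G=G(X,r)$ be its enveloping group, with group operation written $\circ$, and let $\iota\colon X\to G(X,r)$ be the canonical map. Then there exists a unique skew left brace structure over $G(X,r)$ (that is, a unique second group operation $\cdot$ on the set $G(X,r)$ making $(G(X,r),\cdot,\circ)$ a skew left brace) such that its associated solution $r_G$ satisfies $$r_G(\iota\times\iota)=(\iota\times\iota)r.$$ Furthermore, if $B$ is a skew left brace with associated solution $r_B$ and $f\colon X\to B$ is a map such that $(f\times f)r=r_B(f\times f)$, then there exists a unique group homomorphism $\phi\colon G(X,r)\to (B,\circ)$ such that $f=\phi\iota$ and $(\phi\times\phi)r_G=r_B(\phi\times\phi)$.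
   Context: A skew left brace is a set $A$ with two group structures, $(A,\cdot)$ (written $(a,b)\mapsto ab$, with inverse $a^{-1}$, not necessarily abelian) and $(A,\circ)$, such that $a\circ(bc)=(a\circ b)a^{-1}(a\circ c)$ for all $a,b,c\in A$. For $a\in A$, $\lambda_a\colon A\to A$ is the bijective map $\lambda_a(b)=a^{-1}(a\circ b)$. The solution associated with a skew left brace $A$ is $r_A\colon A\times A\to A\times A$, $r_A(a,b)=\left(\lambda_a(b),\lambda^{-1}_{\lambda_a(b)}\left((a\circ b)^{-1}a(a\circ b)\right)\right)$. A (set-theoretical) solution of the Yang--Baxter equation is a pair $(X,r)$ with $X$ a set and $r\colon X\times X\to X\times X$, $r(x,y)=(\sigma_x(y),\tau_y(x))$, a bijective map such that $(r\times\mathrm{id})(\mathrm{id}\times r)(r\times\mathrm{id})=(\mathrm{id}\times r)(r\times\mathrm{id})(\mathrm{id}\times r)$ on $X\times X\times X$. It is non-degenerate if $\sigma_x$ and $\tau_x$ are bijective for every $x\in X$. The enveloping (or structure) group $G(X,r)$ of a solution $(X,r)$ is the group, with operation $\circ$, generated by the elements of $X$ with relations $x\circ y=\sigma_x(y)\circ\tau_y(x)$ for $x,y\in X$; $\iota\colon X\to G(X,r)$ is the canonical map. *)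

theory Defs
  imports "HOL-Algebra.Group"
begin

section \<open>Set-theoretical solutions of the Yang--Baxter equation\<close>

text \<open>
  A map \<open>r\<close> on \<open>X \<times> X\<close> is written \<open>r (x, y) = (\<sigma>\<^sub>x y, \<tau>\<^sub>y x)\<close>; so the subscript of \<open>\<tau>\<close> is the
  second argument of \<open>r\<close>.
\<close>

definition sigma :: "('a \<times> 'a \<Rightarrow> 'a \<times> 'a) \<Rightarrow> 'a \<Rightarrow> 'a \<Rightarrow> 'a" where
  "sigma r x y = fst (r (x, y))"

definition tau :: "('a \<times> 'a \<Rightarrow> 'a \<times> 'a) \<Rightarrow> 'a \<Rightarrow> 'a \<Rightarrow> 'a" where
  "tau r y x = snd (r (x, y))"

definition on_first_two :: "('a \<times> 'a \<Rightarrow> 'a \<times> 'a) \<Rightarrow> 'a \<times> 'a \<times> 'a \<Rightarrow> 'a \<times> 'a \<times> 'a" where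
  "on_first_two r = (\<lambda>(x, y, z). case r (x, y) of (u, v) \<Rightarrow> (u, v, z))"

definition on_last_two :: "('a \<times> 'a \<Rightarrow> 'a \<times> 'a) \<Rightarrow> 'a \<times> 'a \<times> 'a \<Rightarrow> 'a \<times> 'a \<times> 'a" where
  "on_last_two r = (\<lambda>(x, y, z). (x, r (y, z)))"

definition yang_baxter_solution :: "'a set \<Rightarrow> ('a \<times> 'a \<Rightarrow> 'a \<times> 'a) \<Rightarrow> bool" where
  "yang_baxter_solution X r \<longleftrightarrow>
     bij_betw r (X \<times> X) (X \<times> X) \<and>
     (\<forall>t \<in> X \<times> X \<times> X.
        on_first_two r (on_last_two r (on_first_two r t)) =
        on_last_two r (on_first_two r (on_last_two r t)))"

definition nondegenerate :: "'a set \<Rightarrow> ('a \<times> 'a \<Rightarrow> 'a \<times> 'a) \<Rightarrow> bool" where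
  "nondegenerate X r \<longleftrightarrow>
     (\<forall>x \<in> X. bij_betw (sigma r x) X X \<and> bij_betw (tau r x) X X)"

text \<open>\<open>(f \<times> f) r = s (f \<times> f)\<close> as maps on \<open>X \<times> X\<close>:\<close>

definition intertwines ::
  "'a set \<Rightarrow> ('a \<Rightarrow> 'b) \<Rightarrow> ('a \<times> 'a \<Rightarrow> 'a \<times> 'a) \<Rightarrow> ('b \<times> 'b \<Rightarrow> 'b \<times> 'b) \<Rightarrow> bool" where
  "intertwines X f r s \<longleftrightarrow>
     (\<forall>p \<in> X \<times> X. map_prod f f (r p) = s (map_prod f f p))"


section \<open>Skew left braces\<close>

text \<open>
  The two group structures \<open>(A, \<cdot>)\<close> and \<open>(A, \<circ>)\<close> are two group records \<open>D\<close> and \<open>C\<close>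
  with the same carrier.
\<close>

locale skew_left_brace = dot: group D + circ: group C
  for D :: "('a, 'm) monoid_scheme" and C :: "('a, 'n) monoid_scheme" +
  assumes same_carrier: "carrier D = carrier C"
    and brace_compat:
      "\<lbrakk>a \<in> carrier D; b \<in> carrier D; c \<in> carrier D\<rbrakk> \<Longrightarrow>
        a \<otimes>\<^bsub>C\<^esub> (b \<otimes>\<^bsub>D\<^esub> c) = (a \<otimes>\<^bsub>C\<^esub> b) \<otimes>\<^bsub>D\<^esub> inv\<^bsub>D\<^esub> a \<otimes>\<^bsub>D\<^esub> (a \<otimes>\<^bsub>C\<^esub> c)"

definition brace_lambda ::
  "('a, 'm) monoid_scheme \<Rightarrow> ('a, 'n) monoid_scheme \<Rightarrow> 'a \<Rightarrow> 'a \<Rightarrow> 'a" where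
  "brace_lambda D C a b = inv\<^bsub>D\<^esub> a \<otimes>\<^bsub>D\<^esub> (a \<otimes>\<^bsub>C\<^esub> b)"

definition brace_solution ::
  "('a, 'm) monoid_scheme \<Rightarrow> ('a, 'n) monoid_scheme \<Rightarrow> 'a \<times> 'a \<Rightarrow> 'a \<times> 'a" where
  "brace_solution D C = (\<lambda>(a, b).
     (brace_lambda D C a b,
      inv_into (carrier D) (brace_lambda D C (brace_lambda D C a b))
        (inv\<^bsub>D\<^esub> (a \<otimes>\<^bsub>C\<^esub> b) \<otimes>\<^bsub>D\<^esub> a \<otimes>\<^bsub>D\<^esub> (a \<otimes>\<^bsub>C\<^esub> b))))"


section \<open>Groups given by generators and relations\<close>

text \<open>
  A word is a list of letters; \<open>(x, True)\<close> stands for the generator \<open>x\<close> and \<open>(x, False)\<close>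
  for its formal inverse. A pair \<open>(p, q)\<close> of words in \<open>R\<close> is the relation \<open>p = q\<close>.
\<close>

type_synonym 'a word = "('a \<times> bool) list"

definition words :: "'a set \<Rightarrow> 'a word set" where
  "words X = lists (X \<times> UNIV)"

inductive_set presentation_cong :: "'a set \<Rightarrow> ('a word \<times> 'a word) set \<Rightarrow> ('a word \<times> 'a word) set"
  for X :: "'a set" and R :: "('a word \<times> 'a word) set" where
  refl: "w \<in> words X \<Longrightarrow> (w, w) \<in> presentation_cong X R"
| sym: "(u, v) \<in> presentation_cong X R \<Longrightarrow> (v, u) \<in> presentation_cong X R"
| trans: "\<lbrakk>(u, v) \<in> presentation_cong X R; (v, w) \<in> presentation_cong X R\<rbrakk> \<Longrightarrow>
    (u, w) \<in> presentation_cong X R"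
| cancel: "\<lbrakk>u \<in> words X; v \<in> words X; x \<in> X\<rbrakk> \<Longrightarrow>
    (u @ [(x, e), (x, \<not> e)] @ v, u @ v) \<in> presentation_cong X R"
| relation: "\<lbrakk>u \<in> words X; v \<in> words X; p \<in> words X; q \<in> words X; (p, q) \<in> R\<rbrakk> \<Longrightarrow>
    (u @ p @ v, u @ q @ v) \<in> presentation_cong X R"

definition presented_group :: "'a set \<Rightarrow> ('a word \<times> 'a word) set \<Rightarrow> 'a word set monoid" where
  "presented_group X R =
     \<lparr>carrier = words X // presentation_cong X R,
      mult = (\<lambda>A B. \<Union>u \<in> A. \<Union>v \<in> B. presentation_cong X R `` {u @ v}),
      one = presentation_cong X R `` {[]}\<rparr>"

lemma words_simps [simp]:
  "[] \<in> words X" "u @ v \<in> words X \<longleftrightarrow> u \<in> words X \<and> v \<in> words X"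
  "l # u \<in> words X \<longleftrightarrow> fst l \<in> X \<and> u \<in> words X"
  by (cases l; auto simp: words_def)+

lemma presentation_cong_words:
  "(u, v) \<in> presentation_cong X R \<Longrightarrow> u \<in> words X \<and> v \<in> words X"
  by (induction rule: presentation_cong.induct) auto

lemma equiv_presentation_cong: "equiv (words X) (presentation_cong X R)"
proof (rule equivI)
  show "presentation_cong X R \<subseteq> words X \<times> words X"
    by (auto dest: presentation_cong_words)
  show "refl_on (words X) (presentation_cong X R)"
    by (rule refl_onI) (rule presentation_cong.refl)
  show "sym (presentation_cong X R)"
    by (rule symI) (rule presentation_cong.sym)
  show "trans (presentation_cong X R)"
    by (rule transI) (rule presentation_cong.trans)
qed

lemma presentation_cong_context:
  assumes "(u, v) \<in> presentation_cong X R" "a \<in> words X" "b \<in> words X"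
  shows "(a @ u @ b, a @ v @ b) \<in> presentation_cong X R"
  using assms
proof (induction rule: presentation_cong.induct)
  case (cancel u v x e)
  then show ?case using presentation_cong.cancel[of "a @ u" X "v @ b" x e R] by simp
next
  case (relation u v p q)
  then show ?case using presentation_cong.relation[of "a @ u" X "v @ b" p q R] by simp
next
  case (refl w)
  then show ?case by (simp add: presentation_cong.refl)
next
  case (sym u v)
  then show ?case by (simp add: presentation_cong.sym)
next
  case (trans u v w)
  then show ?case by (meson presentation_cong.trans)
qed

lemma presentation_cong_append:
  assumes "(u, u') \<in> presentation_cong X R" "(v, v') \<in> presentation_cong X R"
  shows "(u @ v, u' @ v') \<in> presentation_cong X R"
proof (rule presentation_cong.trans)
  show "(u @ v, u' @ v) \<in> presentation_cong X R"
    using presentation_cong_context[OF assms(1), of "[]" v] presentation_cong_words[OF assms(2)]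
    by simp
  show "(u' @ v, u' @ v') \<in> presentation_cong X R"
    using presentation_cong_context[OF assms(2), of u' "[]"] presentation_cong_words[OF assms(1)]
    by simp
qed

lemma presented_group_mult:
  assumes "u \<in> words X" "v \<in> words X"
  shows "presentation_cong X R `` {u} \<otimes>\<^bsub>presented_group X R\<^esub> presentation_cong X R `` {v}
    = presentation_cong X R `` {u @ v}"
proof -
  let ?c = "\<lambda>w. presentation_cong X R `` {w}"
  have eq: "?c (u' @ v') = ?c (u @ v)" if "u' \<in> ?c u" "v' \<in> ?c v" for u' v'
    using equiv_class_eq[OF equiv_presentation_cong presentation_cong_append[of u u' X R v v']] that
    by simp
  have "(\<Union>u' \<in> ?c u. \<Union>v' \<in> ?c v. ?c (u' @ v')) = (\<Union>u' \<in> ?c u. \<Union>v' \<in> ?c v. ?c (u @ v))"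
    by (intro SUP_cong HOL.refl eq)
  also have "\<dots> = ?c (u @ v)"
  proof -
    have "u \<in> ?c u" "v \<in> ?c v"
      using assms by (simp_all add: presentation_cong.refl)
    then have "?c u \<noteq> {}" "?c v \<noteq> {}" by blast+
    then show ?thesis by (simp only: UN_constant if_False)
  qed
  finally show ?thesis
    by (simp only: presented_group_def monoid.simps)
qed

lemma word_inverse:
  assumes "w \<in> words X"
  shows "\<exists>v \<in> words X. (v @ w, []) \<in> presentation_cong X R"
  using assms
proof (induction w)
  case Nil
  then show ?case by (intro bexI[of _ "[]"]) (auto intro: presentation_cong.refl)
next
  case (Cons l w)
  then obtain v where v: "v \<in> words X" "(v @ w, []) \<in> presentation_cong X R" by auto
  have "((v @ [(fst l, \<not> snd l)]) @ l # w, v @ w) \<in> presentation_cong X R"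
    using presentation_cong.cancel[of v X w "fst l" "\<not> snd l" R] Cons.prems v(1) by simp
  then have "((v @ [(fst l, \<not> snd l)]) @ l # w, []) \<in> presentation_cong X R"
    using v(2) by (rule presentation_cong.trans)
  moreover have "v @ [(fst l, \<not> snd l)] \<in> words X"
    using v(1) Cons.prems by simp
  ultimately show ?case by blast
qed

lemma group_presented_group: "group (presented_group X R)"
proof (rule groupI)
  let ?c = "\<lambda>w. presentation_cong X R `` {w}" and ?G = "presented_group X R"
  have carr: "A \<in> carrier ?G \<longleftrightarrow> (\<exists>w \<in> words X. A = ?c w)" for A
    by (auto simp: presented_group_def quotient_def)
  have one: "\<one>\<^bsub>?G\<^esub> = ?c []"
    by (simp add: presented_group_def)
  show "\<one>\<^bsub>?G\<^esub> \<in> carrier ?G"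
    unfolding carr one by (rule bexI[of _ "[]"]) auto
  show "A \<otimes>\<^bsub>?G\<^esub> B \<in> carrier ?G" if "A \<in> carrier ?G" "B \<in> carrier ?G" for A B
  proof -
    obtain u v where "u \<in> words X" "v \<in> words X" "A = ?c u" "B = ?c v"
      using \<open>A \<in> carrier ?G\<close> \<open>B \<in> carrier ?G\<close> unfolding carr by blast
    then show ?thesis
      unfolding carr by (intro bexI[of _ "u @ v"]) (simp_all add: presented_group_mult)
  qed
  show "A \<otimes>\<^bsub>?G\<^esub> B \<otimes>\<^bsub>?G\<^esub> C = A \<otimes>\<^bsub>?G\<^esub> (B \<otimes>\<^bsub>?G\<^esub> C)"
    if "A \<in> carrier ?G" "B \<in> carrier ?G" "C \<in> carrier ?G" for A B C
    using that unfolding carr by (auto simp: presented_group_mult)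
  show "\<one>\<^bsub>?G\<^esub> \<otimes>\<^bsub>?G\<^esub> A = A" if "A \<in> carrier ?G" for A
    using that unfolding carr one by (auto simp: presented_group_mult)
  show "\<exists>B \<in> carrier ?G. B \<otimes>\<^bsub>?G\<^esub> A = \<one>\<^bsub>?G\<^esub>" if "A \<in> carrier ?G" for A
  proof -
    obtain w where w: "w \<in> words X" "A = ?c w" using \<open>A \<in> carrier ?G\<close> unfolding carr by blast
    obtain v where v: "v \<in> words X" "(v @ w, []) \<in> presentation_cong X R"
      using word_inverse[OF w(1), of R] by blast
    have "?c v \<otimes>\<^bsub>?G\<^esub> A = \<one>\<^bsub>?G\<^esub>"
      using w v equiv_class_eq[OF equiv_presentation_cong v(2)]
      by (simp add: presented_group_mult one)
    moreover have "?c v \<in> carrier ?G"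
      unfolding carr using v(1) by blast
    ultimately show ?thesis by blast
  qed
qed


section \<open>The enveloping group of a solution\<close>

definition enveloping_relations ::
  "'a set \<Rightarrow> ('a \<times> 'a \<Rightarrow> 'a \<times> 'a) \<Rightarrow> ('a word \<times> 'a word) set" where
  "enveloping_relations X r =
     {([(x, True), (y, True)], [(sigma r x y, True), (tau r y x, True)]) | x y. x \<in> X \<and> y \<in> X}"

definition enveloping_group :: "'a set \<Rightarrow> ('a \<times> 'a \<Rightarrow> 'a \<times> 'a) \<Rightarrow> 'a word set monoid" where
  "enveloping_group X r = presented_group X (enveloping_relations X r)"

definition enveloping_map :: "'a set \<Rightarrow> ('a \<times> 'a \<Rightarrow> 'a \<times> 'a) \<Rightarrow> 'a \<Rightarrow> 'a word set" where
  "enveloping_map X r x = presentation_cong X (enveloping_relations X r) `` {[(x, True)]}"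

end

theory Submission imports Defs begin

text \<open>
  Write \<open>\<lambda>\<close> for the action of \<open>G = G(X, r)\<close> on \<open>X\<close> that extends \<open>x \<mapsto> \<sigma>\<^sub>x\<close>; the first component of
  the Yang--Baxter equation says that it exists. In a brace that solves the problem, adding a
  generator has to be \<open>g \<cdot> \<iota> x = g \<circ> \<iota> (\<lambda>\<^sub>g\<inverse> x)\<close>, so everything hinges on the permutations
  \<open>T\<^sub>x : g \<mapsto> g \<circ> \<iota> (\<lambda>\<^sub>g\<inverse> x)\<close> of \<open>G\<close>. They satisfy \<open>T\<^sub>z T\<^sub>x = T\<^bsub>D z x\<^esub> T\<^sub>z\<close>, where
  \<open>D z x = \<sigma>\<^sub>z (\<tau>\<^sub>y x)\<close> for the \<open>y\<close> with \<open>\<sigma>\<^sub>x y = z\<close>. Hence the derived group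
  \<open>A = \<langle>X | z x = (D z x) z\<rangle>\<close> acts on the set \<open>G\<close>.

  In the other direction, each \<open>\<sigma>\<^sub>a\<close> preserves \<open>D\<close> and therefore induces an automorphism of \<open>A\<close>, and
  the affine maps \<open>u \<mapsto> \<sigma>\<^sub>x(u) x\<close> satisfy the relations of \<open>G\<close>. So \<open>G\<close> acts on the set \<open>A\<close>.
  The orbit maps \<open>\<pi> : G \<rightarrow> A\<close> and \<open>A \<rightarrow> G\<close> of the two neutral elements are mutually inverse, because
  \<open>\<pi> (T\<^sub>x g) = x \<pi>(g)\<close> (\<open>cocycle_tr\<close>, \<open>tr_cocycle\<close>). Since \<open>\<pi>\<close> is a
  bijective 1-cocycle, transporting the multiplication of \<open>A\<close> to \<open>G\<close> gives a skew left brace (\<open>skew_left_brace_of_bijective_cocycle\<close>). As \<open>T\<^sub>x\<close> adds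
  \<open>x\<close> on the right while \<open>A\<close> acts from the left, it is the opposite of \<open>A\<close> that is
  transported.

  That \<open>T\<^sub>x\<close> is bijective is where right non-degeneracy enters: it rests on the bijectivity of the
  diagonal map \<open>u \<mapsto> \<sigma>\<^sub>u\<inverse> u\<close> of \<open>X\<close> (\<open>diagonal_unique\<close>, \<open>diagonal_exists\<close>).

  For the universal property, the relations of \<open>G\<close> are visible in the solution of any brace \<open>B\<close>,
  so \<open>f\<close> extends to a \<open>\<circ>\<close>-homomorphism \<open>\<phi>\<close>. On generators the \<open>\<lambda>\<close>-maps of \<open>G\<close> and \<open>B\<close> are
  both dictated by \<open>\<sigma>\<close>, so \<open>\<phi>\<close> respects the addition of a generator, and then all of \<open>\<cdot>\<close>
  (\<open>intertwining_hom_is_brace_hom\<close>). Applied to \<open>B = G\<close> with another brace structure and to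
  the identity, the same lemma gives the uniqueness of \<open>\<cdot>\<close>.
\<close>


section \<open>Presented groups: induction, actions and homomorphisms\<close>

abbreviation presented_generator :: "'a set \<Rightarrow> ('a word \<times> 'a word) set \<Rightarrow> 'a \<Rightarrow> 'a word set" where
  "presented_generator X R x \<equiv> presentation_cong X R `` {[(x, True)]}"

lemma presented_group_carrier:
  "g \<in> carrier (presented_group X R) \<longleftrightarrow> (\<exists>w \<in> words X. g = presentation_cong X R `` {w})"
  by (auto simp: presented_group_def quotient_def)

lemma presented_group_one: "\<one>\<^bsub>presented_group X R\<^esub> = presentation_cong X R `` {[]}"
  by (simp add: presented_group_def)

lemma presented_class_cong:
  "(u, v) \<in> presentation_cong X R \<Longrightarrow> presentation_cong X R `` {u} = presentation_cong X R `` {v}"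
  by (rule equiv_class_eq[OF equiv_presentation_cong])

lemma presented_generator_closed:
  "x \<in> X \<Longrightarrow> presented_generator X R x \<in> carrier (presented_group X R)"
  unfolding presented_group_carrier by (rule bexI[of _ "[(x, True)]"]) auto

lemma presented_class_cancel:
  assumes "x \<in> X" "w \<in> words X"
  shows "presentation_cong X R `` {(x, e) # (x, \<not> e) # w} = presentation_cong X R `` {w}"
    and "presentation_cong X R `` {w @ [(x, e), (x, \<not> e)]} = presentation_cong X R `` {w}"
  using presented_class_cong[OF presentation_cong.cancel[of "[]" X w x e R]]
    presented_class_cong[OF presentation_cong.cancel[of w X "[]" x e R]] assms
  by simp_all

text \<open>
  An equivalence in the induction step deals with a generator and its inverse at once.
\<close>

lemma presented_group_induct_left [consumes 1, case_names one step]: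
  assumes g: "g \<in> carrier (presented_group X R)"
    and one: "P \<one>\<^bsub>presented_group X R\<^esub>"
    and step: "\<And>x g. x \<in> X \<Longrightarrow> g \<in> carrier (presented_group X R) \<Longrightarrow>
      P (presented_generator X R x \<otimes>\<^bsub>presented_group X R\<^esub> g) \<longleftrightarrow> P g"
  shows "P g"
proof -
  let ?c = "\<lambda>w. presentation_cong X R `` {w}"
  have step': "P (?c ((x, True) # w)) \<longleftrightarrow> P (?c w)" if "x \<in> X" "w \<in> words X" for x w
    using step[OF that(1), of "?c w"] that presented_group_mult[of "[(x, True)]" X w R]
    by (auto simp: presented_group_carrier)
  have "P (?c w)" if "w \<in> words X" for w
    using that
  proof (induction w)
    case Nil
    then show ?case using one by (simp add: presented_group_one)
  next
    case (Cons l w)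
    obtain x e where l: "l = (x, e)" by fastforce
    with Cons have xw: "x \<in> X" "w \<in> words X" "P (?c w)" by auto
    show ?case
    proof (cases e)
      case True
      then show ?thesis using step' xw l by simp
    next
      case False
      then show ?thesis
        using step'[of x "(x, False) # w"] presented_class_cancel(1)[OF xw(1,2), of R True] xw l
        by simp
    qed
  qed
  then show ?thesis using g unfolding presented_group_carrier by blast
qed

lemma presented_group_induct_right [consumes 1, case_names one step]:
  assumes g: "g \<in> carrier (presented_group X R)"
    and one: "P \<one>\<^bsub>presented_group X R\<^esub>"
    and step: "\<And>x g. x \<in> X \<Longrightarrow> g \<in> carrier (presented_group X R) \<Longrightarrow>
      P (g \<otimes>\<^bsub>presented_group X R\<^esub> presented_generator X R x) \<longleftrightarrow> P g"
  shows "P g"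
proof -
  let ?c = "\<lambda>w. presentation_cong X R `` {w}"
  have step': "P (?c (w @ [(x, True)])) \<longleftrightarrow> P (?c w)" if "x \<in> X" "w \<in> words X" for x w
    using step[OF that(1), of "?c w"] that presented_group_mult[of w X "[(x, True)]" R]
    by (auto simp: presented_group_carrier)
  have "P (?c w)" if "w \<in> words X" for w
    using that
  proof (induction w rule: rev_induct)
    case Nil
    then show ?case using one by (simp add: presented_group_one)
  next
    case (snoc l w)
    obtain x e where l: "l = (x, e)" by fastforce
    with snoc have xw: "x \<in> X" "w \<in> words X" "P (?c w)" by auto
    show ?case
    proof (cases e)
      case True
      then show ?thesis using step' xw l by simp
    next
      case False
      then show ?thesis
        using step'[of x "w @ [(x, False)]"] presented_class_cancel(2)[OF xw(1,2), of R False] xw l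
        by simp
    qed
  qed
  then show ?thesis using g unfolding presented_group_carrier by blast
qed

text \<open>
  Acting on a plain set, instead of mapping to a symmetric group, keeps the maps free of
  extensionality conditions; the letters \<open>(x, False)\<close> then need \<open>inv_into\<close> to undo a generator on \<open>S\<close>.
\<close>

primrec word_act :: "'s set \<Rightarrow> ('a \<Rightarrow> 's \<Rightarrow> 's) \<Rightarrow> 'a word \<Rightarrow> 's \<Rightarrow> 's" where
  "word_act S act [] s = s"
| "word_act S act (l # w) s =
    (if snd l then act (fst l) else inv_into S (act (fst l))) (word_act S act w s)"

lemma word_act_append: "word_act S act (u @ v) s = word_act S act u (word_act S act v s)"
  by (induction u) auto

text \<open>
  The action of a group element is the action of any representing word; that the choice does not
  matter is \<open>word_act_cong\<close> below.
\<close>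

definition presented_act :: "'s set \<Rightarrow> ('a \<Rightarrow> 's \<Rightarrow> 's) \<Rightarrow> 'a word set \<Rightarrow> 's \<Rightarrow> 's" where
  "presented_act S act g = word_act S act (SOME w. w \<in> g)"

locale generator_action =
  fixes X :: "'a set" and R :: "('a word \<times> 'a word) set" and S :: "'s set"
    and act :: "'a \<Rightarrow> 's \<Rightarrow> 's"
  assumes act_bij: "x \<in> X \<Longrightarrow> bij_betw (act x) S S"
    and act_relation: "\<lbrakk>(p, q) \<in> R; p \<in> words X; q \<in> words X; s \<in> S\<rbrakk> \<Longrightarrow>
      word_act S act p s = word_act S act q s"
begin

lemma word_act_closed: "w \<in> words X \<Longrightarrow> s \<in> S \<Longrightarrow> word_act S act w s \<in> S"
proof (induction w)
  case (Cons l w)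
  then show ?case
    using act_bij[of "fst l"] bij_betw_apply[OF bij_betw_inv_into[OF act_bij[of "fst l"]]]
    by (auto dest: bij_betw_apply)
qed simp

lemma word_act_cong:
  "(u, v) \<in> presentation_cong X R \<Longrightarrow> s \<in> S \<Longrightarrow> word_act S act u s = word_act S act v s"
proof (induction arbitrary: s rule: presentation_cong.induct)
  case (cancel u v x e)
  have "word_act S act v s \<in> S" using cancel word_act_closed by blast
  then have "word_act S act [(x, e), (x, \<not> e)] (word_act S act v s) = word_act S act v s"
    using act_bij[OF cancel(3)]
    by (auto simp: bij_betw_inv_into_left bij_betw_inv_into_right)
  then show ?case by (simp only: word_act_append)
next
  case (relation u v p q)
  then show ?case by (simp add: word_act_append act_relation word_act_closed)
next
  case (trans u v w)
  show ?case by (rule trans.IH(1)[OF trans.prems, THEN HOL.trans]) (rule trans.IH(2)[OF trans.prems])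
next
  case (sym u v)
  show ?case by (rule sym.IH[OF sym.prems, symmetric])
qed (rule HOL.refl)

abbreviation "\<Phi> \<equiv> presented_act S act"

lemma presented_act_class:
  assumes "w \<in> words X" "s \<in> S"
  shows "\<Phi> (presentation_cong X R `` {w}) s = word_act S act w s"
proof -
  have "w \<in> presentation_cong X R `` {w}" using assms by (simp add: presentation_cong.refl)
  then have "(SOME v. v \<in> presentation_cong X R `` {w}) \<in> presentation_cong X R `` {w}"
    by (rule someI)
  then have "(w, SOME v. v \<in> presentation_cong X R `` {w}) \<in> presentation_cong X R" by simp
  from word_act_cong[OF this assms(2)] show ?thesis by (simp add: presented_act_def)
qed

lemma act_closed: "g \<in> carrier (presented_group X R) \<Longrightarrow> s \<in> S \<Longrightarrow> \<Phi> g s \<in> S"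
  by (auto simp: presented_group_carrier presented_act_class word_act_closed)

lemma act_one: "s \<in> S \<Longrightarrow> \<Phi> \<one>\<^bsub>presented_group X R\<^esub> s = s"
  by (simp add: presented_group_one presented_act_class)

lemma act_mult:
  assumes "g \<in> carrier (presented_group X R)" "h \<in> carrier (presented_group X R)" "s \<in> S"
  shows "\<Phi> (g \<otimes>\<^bsub>presented_group X R\<^esub> h) s = \<Phi> g (\<Phi> h s)"
  using assms
  by (auto simp: presented_group_carrier presented_group_mult presented_act_class
      word_act_append word_act_closed)

lemma act_generator: "x \<in> X \<Longrightarrow> s \<in> S \<Longrightarrow> \<Phi> (presented_generator X R x) s = act x s"
  by (simp add: presented_act_class)

lemma act_inv:
  assumes "g \<in> carrier (presented_group X R)" "s \<in> S"
  shows "\<Phi> (inv\<^bsub>presented_group X R\<^esub> g) (\<Phi> g s) = s" "\<Phi> g (\<Phi> (inv\<^bsub>presented_group X R\<^esub> g) s) = s"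
  using assms act_mult[of "inv\<^bsub>presented_group X R\<^esub> g" g s]
    act_mult[of g "inv\<^bsub>presented_group X R\<^esub> g" s]
  by (simp_all add: group.inv_closed group.l_inv group.r_inv group_presented_group act_one)

lemma act_inj:
  assumes "g \<in> carrier (presented_group X R)" "s \<in> S" "t \<in> S" "\<Phi> g s = \<Phi> g t"
  shows "s = t"
  using act_inv(1)[OF assms(1,2)] act_inv(1)[OF assms(1,3)] assms(4) by metis

end

text \<open>
  Von Dyck's theorem, for relations between products of two generators. The group \<open>H\<close> is acted on by
  left multiplication with the prescribed images; the homomorphism is the orbit map of the
  neutral element.
\<close>

lemma presented_group_hom_exists:
  assumes "group H" and f: "\<And>x. x \<in> X \<Longrightarrow> f x \<in> carrier H"
    and rel: "\<And>p q. (p, q) \<in> R \<Longrightarrow> \<exists>x \<in> X. \<exists>y \<in> X. \<exists>x' \<in> X. \<exists>y' \<in> X.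
      p = [(x, True), (y, True)] \<and> q = [(x', True), (y', True)] \<and> f x \<otimes>\<^bsub>H\<^esub> f y = f x' \<otimes>\<^bsub>H\<^esub> f y'"
  shows "\<exists>\<phi> \<in> hom (presented_group X R) H. \<forall>x \<in> X. \<phi> (presented_generator X R x) = f x"
proof -
  interpret H: group H by fact
  let ?act = "\<lambda>x h. f x \<otimes>\<^bsub>H\<^esub> h" and ?G = "presented_group X R"
  interpret generator_action X R "carrier H" ?act
  proof
    show "bij_betw (?act x) (carrier H) (carrier H)" if "x \<in> X" for x
    proof (rule bij_betw_byWitness[where f' = "\<lambda>h. inv\<^bsub>H\<^esub> f x \<otimes>\<^bsub>H\<^esub> h"])
    qed (use f[OF that] in \<open>auto simp: H.m_assoc[symmetric]\<close>)
    show "word_act (carrier H) ?act p s = word_act (carrier H) ?act q s"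
      if pq: "(p, q) \<in> R" and s: "s \<in> carrier H" for p q s
    proof -
      obtain x y x' y' where "x \<in> X" "y \<in> X" "x' \<in> X" "y' \<in> X" "p = [(x, True), (y, True)]"
        "q = [(x', True), (y', True)]" "f x \<otimes>\<^bsub>H\<^esub> f y = f x' \<otimes>\<^bsub>H\<^esub> f y'"
        using rel[OF pq] by blast
      then show ?thesis using f s by (simp add: H.m_assoc[symmetric])
    qed
  qed
  interpret G: group ?G by (rule group_presented_group)
  have translation: "\<Phi> g s = \<Phi> g \<one>\<^bsub>H\<^esub> \<otimes>\<^bsub>H\<^esub> s" if "g \<in> carrier ?G" "s \<in> carrier H" for g s
    using that
  proof (induction g rule: presented_group_induct_left)
    case one
    then show ?case by (simp add: act_one)
  next
    case (step x g)
    then show ?case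
      by (simp add: act_mult act_generator presented_generator_closed act_closed f H.m_assoc)
  qed
  show ?thesis
  proof (rule bexI[of _ "\<lambda>g. \<Phi> g \<one>\<^bsub>H\<^esub>"])
    show "\<forall>x\<in>X. \<Phi> (presented_generator X R x) \<one>\<^bsub>H\<^esub> = f x"
      by (simp add: act_generator f)
    show "(\<lambda>g. \<Phi> g \<one>\<^bsub>H\<^esub>) \<in> hom ?G H"
    proof (rule homI)
      show "\<Phi> g \<one>\<^bsub>H\<^esub> \<in> carrier H" if "g \<in> carrier ?G" for g
        using that by (simp add: act_closed)
      show "\<Phi> (g \<otimes>\<^bsub>?G\<^esub> h) \<one>\<^bsub>H\<^esub> = \<Phi> g \<one>\<^bsub>H\<^esub> \<otimes>\<^bsub>H\<^esub> \<Phi> h \<one>\<^bsub>H\<^esub>"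
        if "g \<in> carrier ?G" "h \<in> carrier ?G" for g h
        using that translation[of g "\<Phi> h \<one>\<^bsub>H\<^esub>"] by (simp add: act_mult act_closed)
    qed
  qed
qed

lemma presented_group_hom_unique:
  assumes "group H" "\<phi> \<in> hom (presented_group X R) H" "\<psi> \<in> hom (presented_group X R) H"
    and eq: "\<And>x. x \<in> X \<Longrightarrow> \<phi> (presented_generator X R x) = \<psi> (presented_generator X R x)"
    and g: "g \<in> carrier (presented_group X R)"
  shows "\<phi> g = \<psi> g"
proof -
  interpret H: group H by fact
  interpret \<phi>: group_hom "presented_group X R" H \<phi>
    by (rule group_hom.intro) (auto simp: group_hom_axioms_def group_presented_group assms)
  interpret \<psi>: group_hom "presented_group X R" H \<psi>
    by (rule group_hom.intro) (auto simp: group_hom_axioms_def group_presented_group assms)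
  show ?thesis using g
  proof (induction g rule: presented_group_induct_left)
    case one
    then show ?case by simp
  next
    case (step x g)
    have "\<psi> (presented_generator X R x) \<in> carrier H"
      using step(1) by (intro \<psi>.hom_closed presented_generator_closed)
    moreover have "\<phi> (presented_generator X R x \<otimes>\<^bsub>presented_group X R\<^esub> g) = \<psi> (presented_generator X R x) \<otimes>\<^bsub>H\<^esub> \<phi> g"
      using \<phi>.hom_mult[OF presented_generator_closed[OF step(1)] step(2)] eq[OF step(1)] by simp
    moreover have "\<psi> (presented_generator X R x \<otimes>\<^bsub>presented_group X R\<^esub> g) = \<psi> (presented_generator X R x) \<otimes>\<^bsub>H\<^esub> \<psi> g"
      using \<psi>.hom_mult[OF presented_generator_closed[OF step(1)] step(2)] by simp
    ultimately show ?case
      using step(2) by simp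
  qed
qed


section \<open>Skew left braces\<close>

context skew_left_brace
begin

lemma one_eq: "\<one>\<^bsub>C\<^esub> = \<one>\<^bsub>D\<^esub>"
proof -
  have c: "\<one>\<^bsub>C\<^esub> \<in> carrier D" by (simp add: same_carrier)
  have "\<one>\<^bsub>C\<^esub> \<otimes>\<^bsub>C\<^esub> \<one>\<^bsub>D\<^esub> = \<one>\<^bsub>D\<^esub>"
    using circ.l_one[of "\<one>\<^bsub>D\<^esub>"] by (simp add: same_carrier[symmetric])
  then have "\<one>\<^bsub>D\<^esub> = inv\<^bsub>D\<^esub> \<one>\<^bsub>C\<^esub>"
    using brace_compat[of "\<one>\<^bsub>C\<^esub>" "\<one>\<^bsub>D\<^esub>" "\<one>\<^bsub>D\<^esub>"] c by simp
  then have "inv\<^bsub>D\<^esub> \<one>\<^bsub>D\<^esub> = inv\<^bsub>D\<^esub> (inv\<^bsub>D\<^esub> \<one>\<^bsub>C\<^esub>)" by simp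
  then show ?thesis using c by simp
qed

lemma circ_closed: "a \<in> carrier D \<Longrightarrow> b \<in> carrier D \<Longrightarrow> a \<otimes>\<^bsub>C\<^esub> b \<in> carrier D"
  by (simp add: same_carrier)

lemma circ_inv_closed: "a \<in> carrier D \<Longrightarrow> inv\<^bsub>C\<^esub> a \<in> carrier D"
  by (simp add: same_carrier)

lemma lambda_closed: "a \<in> carrier D \<Longrightarrow> b \<in> carrier D \<Longrightarrow> brace_lambda D C a b \<in> carrier D"
  by (simp add: brace_lambda_def circ_closed)

lemma circ_eq_dot_lambda:
  "a \<in> carrier D \<Longrightarrow> b \<in> carrier D \<Longrightarrow> a \<otimes>\<^bsub>C\<^esub> b = a \<otimes>\<^bsub>D\<^esub> brace_lambda D C a b"
  by (simp add: brace_lambda_def circ_closed dot.m_assoc[symmetric])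

lemma lambda_dot:
  assumes "a \<in> carrier D" "b \<in> carrier D" "c \<in> carrier D"
  shows "brace_lambda D C a (b \<otimes>\<^bsub>D\<^esub> c) = brace_lambda D C a b \<otimes>\<^bsub>D\<^esub> brace_lambda D C a c"
  using assms by (simp add: brace_lambda_def brace_compat dot.m_assoc circ_closed)

lemma lambda_circ:
  assumes "a \<in> carrier D" "b \<in> carrier D" "c \<in> carrier D"
  shows "brace_lambda D C (a \<otimes>\<^bsub>C\<^esub> b) c = brace_lambda D C a (brace_lambda D C b c)"
proof -
  let ?l = "brace_lambda D C"
  have "(a \<otimes>\<^bsub>C\<^esub> b) \<otimes>\<^bsub>D\<^esub> ?l (a \<otimes>\<^bsub>C\<^esub> b) c = a \<otimes>\<^bsub>C\<^esub> (b \<otimes>\<^bsub>D\<^esub> ?l b c)"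
    using assms by (simp add: circ_eq_dot_lambda[symmetric] circ_closed)
      (simp add: same_carrier circ.m_assoc)
  also have "\<dots> = a \<otimes>\<^bsub>D\<^esub> (?l a b \<otimes>\<^bsub>D\<^esub> ?l a (?l b c))"
    using assms by (simp add: circ_eq_dot_lambda lambda_closed lambda_dot)
  also have "\<dots> = (a \<otimes>\<^bsub>C\<^esub> b) \<otimes>\<^bsub>D\<^esub> ?l a (?l b c)"
    using assms by (simp add: circ_eq_dot_lambda lambda_closed dot.m_assoc)
  finally show ?thesis using assms by (simp add: circ_closed lambda_closed)
qed

lemma lambda_one: "b \<in> carrier D \<Longrightarrow> brace_lambda D C \<one>\<^bsub>C\<^esub> b = b"
  using circ.l_one[of b] dot.inv_one unfolding one_eq[symmetric]
  by (simp add: brace_lambda_def same_carrier one_eq)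

lemma lambda_inv:
  assumes "a \<in> carrier D" "b \<in> carrier D"
  shows "brace_lambda D C a (brace_lambda D C (inv\<^bsub>C\<^esub> a) b) = b"
    and "brace_lambda D C (inv\<^bsub>C\<^esub> a) (brace_lambda D C a b) = b"
proof -
  have "a \<otimes>\<^bsub>C\<^esub> inv\<^bsub>C\<^esub> a = \<one>\<^bsub>C\<^esub>" "inv\<^bsub>C\<^esub> a \<otimes>\<^bsub>C\<^esub> a = \<one>\<^bsub>C\<^esub>"
    using assms by (simp_all add: same_carrier)
  note cancel = this and inv = circ_inv_closed[OF assms(1)]
  show "brace_lambda D C a (brace_lambda D C (inv\<^bsub>C\<^esub> a) b) = b"
    unfolding lambda_circ[OF assms(1) inv assms(2), symmetric] cancel by (rule lambda_one) fact
  show "brace_lambda D C (inv\<^bsub>C\<^esub> a) (brace_lambda D C a b) = b"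
    unfolding lambda_circ[OF inv assms, symmetric] cancel by (rule lambda_one) fact
qed

lemma lambda_inj:
  assumes "a \<in> carrier D" "b \<in> carrier D" "c \<in> carrier D"
    and "brace_lambda D C a b = brace_lambda D C a c"
  shows "b = c"
  proof -
  let ?l = "brace_lambda D C (inv\<^bsub>C\<^esub> a)"
  have "b = ?l (brace_lambda D C a b)" by (rule lambda_inv(2)[OF assms(1,2), symmetric])
  also have "\<dots> = ?l (brace_lambda D C a c)" by (rule arg_cong[OF assms(4)])
  also have "\<dots> = c" by (rule lambda_inv(2)[OF assms(1,3)])
  finally show ?thesis .
qed

text \<open>
  Applying \<open>\<lambda>\<^sub>u\<close>, with \<open>u = \<lambda>\<^sub>a(b)\<close>, to the right-hand component below gives
  \<open>u\<inverse> \<cdot> (a \<circ> b)\<close>, which is the argument of \<open>\<lambda>\<^sub>u\<inverse>\<close> in the definition of the solution. In this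
  form the solution splits \<open>a \<circ> b\<close> as a product in the circle group, which connects it with the
  relations of the enveloping group.
\<close>

lemma brace_solution_eq:
  assumes a: "a \<in> carrier D" and b: "b \<in> carrier D"
  shows "brace_solution D C (a, b) =
    (brace_lambda D C a b, inv\<^bsub>C\<^esub> (brace_lambda D C a b) \<otimes>\<^bsub>C\<^esub> (a \<otimes>\<^bsub>C\<^esub> b))"
proof -
  let ?u = "brace_lambda D C a b"
  let ?v = "inv\<^bsub>C\<^esub> ?u \<otimes>\<^bsub>C\<^esub> (a \<otimes>\<^bsub>C\<^esub> b)"
  have u: "?u \<in> carrier D" and ab: "a \<otimes>\<^bsub>C\<^esub> b \<in> carrier D"
    using a b by (simp_all add: lambda_closed circ_closed)
  have v: "?v \<in> carrier D" using u ab by (simp add: circ_closed circ_inv_closed)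
  have "?u \<otimes>\<^bsub>C\<^esub> ?v = a \<otimes>\<^bsub>C\<^esub> b"
    using u ab unfolding same_carrier by (simp add: circ.m_assoc[symmetric])
  then have "brace_lambda D C ?u ?v = inv\<^bsub>D\<^esub> ?u \<otimes>\<^bsub>D\<^esub> (a \<otimes>\<^bsub>C\<^esub> b)"
    by (simp add: brace_lambda_def[of D C ?u ?v])
  also have "\<dots> = inv\<^bsub>D\<^esub> (a \<otimes>\<^bsub>C\<^esub> b) \<otimes>\<^bsub>D\<^esub> a \<otimes>\<^bsub>D\<^esub> (a \<otimes>\<^bsub>C\<^esub> b)"
    using a ab by (simp add: brace_lambda_def dot.inv_mult_group)
  finally have "inv_into (carrier D) (brace_lambda D C ?u)
      (inv\<^bsub>D\<^esub> (a \<otimes>\<^bsub>C\<^esub> b) \<otimes>\<^bsub>D\<^esub> a \<otimes>\<^bsub>D\<^esub> (a \<otimes>\<^bsub>C\<^esub> b)) = ?v"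
    using v u by (intro inv_into_f_eq) (auto intro!: inj_onI dest: lambda_inj)
  then show ?thesis by (simp add: brace_solution_def)
qed

end

lemma intertwines_brace_solutions:
  assumes "skew_left_brace D C" "skew_left_brace BD BC" "\<phi> \<in> hom C BC" "\<phi> \<in> hom D BD"
  shows "intertwines (carrier C) \<phi> (brace_solution D C) (brace_solution BD BC)"
proof -
  interpret A: skew_left_brace D C by fact
  interpret B: skew_left_brace BD BC by fact
  interpret circ: group_hom C BC \<phi>
    by (rule group_hom.intro) (auto simp: group_hom_axioms_def assms A.circ.is_group B.circ.is_group)
  interpret dot: group_hom D BD \<phi>
    by (rule group_hom.intro) (auto simp: group_hom_axioms_def assms A.dot.is_group B.dot.is_group)
  have lam: "\<phi> (brace_lambda D C a b) = brace_lambda BD BC (\<phi> a) (\<phi> b)"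
    if "a \<in> carrier D" "b \<in> carrier D" for a b
    using that circ.hom_mult[of a b]
    by (simp add: brace_lambda_def A.circ_closed A.same_carrier[symmetric])
  have "map_prod \<phi> \<phi> (brace_solution D C (a, b)) = brace_solution BD BC (\<phi> a, \<phi> b)"
    if a: "a \<in> carrier D" and b: "b \<in> carrier D" for a b
  proof -
    have "brace_lambda D C a b \<in> carrier C" "a \<in> carrier C" "b \<in> carrier C"
      using A.lambda_closed[OF a b] a b by (simp_all add: A.same_carrier)
    then show ?thesis
      using a b by (simp add: A.brace_solution_eq B.brace_solution_eq lam)
  qed
  then show ?thesis by (auto simp: intertwines_def A.same_carrier)
qed

definition transported_group :: "'a set \<Rightarrow> ('a \<Rightarrow> 'b) \<Rightarrow> 'b monoid \<Rightarrow> 'a monoid" where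
  "transported_group S \<pi> A = \<lparr>carrier = S,
     mult = (\<lambda>g h. inv_into S \<pi> (\<pi> g \<otimes>\<^bsub>A\<^esub> \<pi> h)), one = inv_into S \<pi> \<one>\<^bsub>A\<^esub>\<rparr>"

lemma transported_group:
  assumes "group A" and \<pi>: "bij_betw \<pi> S (carrier A)"
  shows "group (transported_group S \<pi> A)"
    and "\<lbrakk>g \<in> S; h \<in> S\<rbrakk> \<Longrightarrow> \<pi> (g \<otimes>\<^bsub>transported_group S \<pi> A\<^esub> h) = \<pi> g \<otimes>\<^bsub>A\<^esub> \<pi> h"
proof -
  interpret A: group A by fact
  let ?D = "transported_group S \<pi> A"
  have \<pi>_closed: "\<pi> g \<in> carrier A" if "g \<in> S" for g using \<pi> that by (rule bij_betw_apply)
  have i: "inv_into S \<pi> a \<in> S" "\<pi> (inv_into S \<pi> a) = a" if "a \<in> carrier A" for a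
    using \<pi> that by (simp_all add: bij_betw_inv_into_right bij_betw_apply[OF bij_betw_inv_into])
  have \<pi>_inj: "g = h" if "\<pi> g = \<pi> h" "g \<in> S" "h \<in> S" for g h
    using \<pi> that by (simp add: bij_betw_def inj_on_def)
  have m: "g \<otimes>\<^bsub>?D\<^esub> h \<in> S" "\<pi> (g \<otimes>\<^bsub>?D\<^esub> h) = \<pi> g \<otimes>\<^bsub>A\<^esub> \<pi> h" if "g \<in> S" "h \<in> S" for g h
    using that by (simp_all add: transported_group_def i \<pi>_closed)
  have o: "\<one>\<^bsub>?D\<^esub> \<in> S" "\<pi> \<one>\<^bsub>?D\<^esub> = \<one>\<^bsub>A\<^esub>" by (simp_all add: transported_group_def i)
  have [simp]: "carrier ?D = S" by (simp add: transported_group_def)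
  show "\<lbrakk>g \<in> S; h \<in> S\<rbrakk> \<Longrightarrow> \<pi> (g \<otimes>\<^bsub>?D\<^esub> h) = \<pi> g \<otimes>\<^bsub>A\<^esub> \<pi> h" by (rule m)
  show "group ?D"
  proof (rule groupI)
    fix g h k assume *: "g \<in> carrier ?D" "h \<in> carrier ?D" "k \<in> carrier ?D"
    show "g \<otimes>\<^bsub>?D\<^esub> h \<otimes>\<^bsub>?D\<^esub> k = g \<otimes>\<^bsub>?D\<^esub> (h \<otimes>\<^bsub>?D\<^esub> k)"
      using * by (intro \<pi>_inj) (simp_all add: m \<pi>_closed A.m_assoc)
  next
    fix g assume *: "g \<in> carrier ?D"
    show "\<one>\<^bsub>?D\<^esub> \<otimes>\<^bsub>?D\<^esub> g = g" using * by (intro \<pi>_inj) (simp_all add: m o \<pi>_closed)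
    show "\<exists>h \<in> carrier ?D. h \<otimes>\<^bsub>?D\<^esub> g = \<one>\<^bsub>?D\<^esub>"
      using * by (intro bexI[of _ "inv_into S \<pi> (inv\<^bsub>A\<^esub> \<pi> g)"] \<pi>_inj) (simp_all add: m o i \<pi>_closed)
  qed (simp_all add: m o)
qed

text \<open>
  Applied to both sides, \<open>\<pi>\<close> turns the brace identity into
  \<open>\<pi>(a) \<Lambda>\<^sub>a(\<pi>(b)) \<Lambda>\<^sub>a(\<pi>(c)) = \<pi>(a) \<Lambda>\<^sub>a(\<pi>(b)) \<pi>(a)\<inverse> \<pi>(a) \<Lambda>\<^sub>a(\<pi>(c))\<close>.
\<close>

lemma skew_left_brace_of_bijective_cocycle:
  assumes "group C" "group A" and \<pi>: "bij_betw \<pi> (carrier C) (carrier A)"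
    and \<Lambda>: "\<And>g. g \<in> carrier C \<Longrightarrow> \<Lambda> g \<in> hom A A"
    and cocycle: "\<And>g h. \<lbrakk>g \<in> carrier C; h \<in> carrier C\<rbrakk> \<Longrightarrow> \<pi> (g \<otimes>\<^bsub>C\<^esub> h) = \<pi> g \<otimes>\<^bsub>A\<^esub> \<Lambda> g (\<pi> h)"
  shows "skew_left_brace (transported_group (carrier C) \<pi> A) C"
    and "\<lbrakk>g \<in> carrier C; h \<in> carrier C\<rbrakk> \<Longrightarrow>
      \<pi> (brace_lambda (transported_group (carrier C) \<pi> A) C g h) = \<Lambda> g (\<pi> h)"
proof -
  let ?D = "transported_group (carrier C) \<pi> A"
  interpret C: group C by fact
  interpret A: group A by fact
  interpret D: group ?D by (rule transported_group) fact+
  have carr: "carrier ?D = carrier C" by (simp add: transported_group_def)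
  note \<pi>_mult = transported_group(2)[OF \<open>group A\<close> \<pi>]
  have \<pi>_closed: "\<pi> g \<in> carrier A" if "g \<in> carrier C" for g using \<pi> that by (rule bij_betw_apply)
  interpret \<pi>: group_hom ?D A \<pi>
    by (rule group_hom.intro)
      (auto simp: group_hom_axioms_def D.is_group A.is_group carr hom_def \<pi>_mult \<pi>_closed)
  have \<pi>_inv: "\<pi> (inv\<^bsub>?D\<^esub> g) = inv\<^bsub>A\<^esub> \<pi> g" and inv_closed: "inv\<^bsub>?D\<^esub> g \<in> carrier C"
    if "g \<in> carrier C" for g
    using \<pi>.hom_inv[of g] D.inv_closed[of g] that by (simp_all add: carr)
  have m_closed: "g \<otimes>\<^bsub>?D\<^esub> h \<in> carrier C" if "g \<in> carrier C" "h \<in> carrier C" for g h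
    using D.m_closed[of g h] that by (simp add: carr)
  have \<Lambda>_closed: "\<Lambda> g a \<in> carrier A" if "g \<in> carrier C" "a \<in> carrier A" for g a
    using \<Lambda>[OF that(1)] that(2) by (auto simp: hom_def)
  show "\<pi> (brace_lambda ?D C g h) = \<Lambda> g (\<pi> h)" if "g \<in> carrier C" "h \<in> carrier C"
    using that by (simp add: brace_lambda_def \<pi>_mult inv_closed \<pi>_inv cocycle \<pi>_closed \<Lambda>_closed
        A.m_assoc[symmetric])
  show "skew_left_brace ?D C"
  proof (intro skew_left_brace.intro skew_left_brace_axioms.intro)
    fix a b c assume "a \<in> carrier ?D" "b \<in> carrier ?D" "c \<in> carrier ?D"
    then have *: "a \<in> carrier C" "b \<in> carrier C" "c \<in> carrier C" by (simp_all add: carr)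
    have "\<pi> (a \<otimes>\<^bsub>C\<^esub> (b \<otimes>\<^bsub>?D\<^esub> c)) =
        \<pi> ((a \<otimes>\<^bsub>C\<^esub> b) \<otimes>\<^bsub>?D\<^esub> inv\<^bsub>?D\<^esub> a \<otimes>\<^bsub>?D\<^esub> (a \<otimes>\<^bsub>C\<^esub> c))"
      using * hom_mult[OF \<Lambda>[of a], of "\<pi> b" "\<pi> c"]
      by (simp add: cocycle \<pi>_mult m_closed inv_closed \<pi>_inv \<pi>_closed \<Lambda>_closed A.m_assoc A.inv_solve_left)
    then show "a \<otimes>\<^bsub>C\<^esub> (b \<otimes>\<^bsub>?D\<^esub> c) = (a \<otimes>\<^bsub>C\<^esub> b) \<otimes>\<^bsub>?D\<^esub> inv\<^bsub>?D\<^esub> a \<otimes>\<^bsub>?D\<^esub> (a \<otimes>\<^bsub>C\<^esub> c)"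
      using \<pi> * m_closed inv_closed by (auto simp: bij_betw_def dest!: inj_onD)
  qed (simp_all add: carr C.is_group D.is_group)
qed

lemma opposite_group:
  assumes "group A"
  shows "group \<lparr>carrier = carrier A, mult = (\<lambda>a b. b \<otimes>\<^bsub>A\<^esub> a), one = \<one>\<^bsub>A\<^esub>\<rparr>"
proof -
  interpret A: group A by fact
  show ?thesis
    by (rule groupI) (auto simp: A.m_assoc intro: A.r_inv_ex)
qed


section \<open>Consequences of the Yang--Baxter equation\<close>

locale nondegenerate_solution =
  fixes X :: "'a set" and r :: "'a \<times> 'a \<Rightarrow> 'a \<times> 'a"
  assumes solution: "yang_baxter_solution X r" and nondegenerate: "nondegenerate X r"
begin

lemma sigma_bij: "x \<in> X \<Longrightarrow> bij_betw (sigma r x) X X"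
  using nondegenerate by (simp add: nondegenerate_def)

lemma tau_bij: "x \<in> X \<Longrightarrow> bij_betw (tau r x) X X"
  using nondegenerate by (simp add: nondegenerate_def)

lemma sigma_closed: "x \<in> X \<Longrightarrow> y \<in> X \<Longrightarrow> sigma r x y \<in> X"
  using sigma_bij by (rule bij_betw_apply)

lemma tau_closed: "x \<in> X \<Longrightarrow> y \<in> X \<Longrightarrow> tau r x y \<in> X"
  using tau_bij by (rule bij_betw_apply)

lemma sigma_inj: "\<lbrakk>sigma r x y = sigma r x z; x \<in> X; y \<in> X; z \<in> X\<rbrakk> \<Longrightarrow> y = z"
  using sigma_bij[of x] by (simp add: bij_betw_def inj_on_def)

lemma sigma_surj:
  assumes "x \<in> X" "z \<in> X"
  obtains y where "y \<in> X" "z = sigma r x y"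
  using sigma_bij[OF assms(1)] assms(2) unfolding bij_betw_def by (metis imageE)

lemma yang_baxter:
  assumes "x \<in> X" "y \<in> X" "z \<in> X"
  shows "sigma r x (sigma r y z) = sigma r (sigma r x y) (sigma r (tau r y x) z)"
    and "tau r (sigma r (tau r y x) z) (sigma r x y) = sigma r (tau r (sigma r y z) x) (tau r z y)"
proof -
  have r: "r (u, v) = (sigma r u v, tau r v u)" for u v by (simp add: sigma_def tau_def)
  have "on_first_two r (on_last_two r (on_first_two r (x, y, z))) =
      on_last_two r (on_first_two r (on_last_two r (x, y, z)))"
    using solution assms unfolding yang_baxter_solution_def by blast
  then show "sigma r x (sigma r y z) = sigma r (sigma r x y) (sigma r (tau r y x) z)"
    and "tau r (sigma r (tau r y x) z) (sigma r x y) = sigma r (tau r (sigma r y z) x) (tau r z y)"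
    by (simp_all add: on_first_two_def on_last_two_def r)
qed

text \<open>
  The rack operation of the derived solution. In the brace to be constructed, \<open>derived z x\<close> is the
  conjugate \<open>z\<inverse> \<cdot> x \<cdot> z\<close>.
\<close>

definition derived :: "'a \<Rightarrow> 'a \<Rightarrow> 'a" where
  "derived z x = sigma r z (tau r (inv_into X (sigma r x) z) x)"

lemma derived_sigma:
  "x \<in> X \<Longrightarrow> y \<in> X \<Longrightarrow> derived (sigma r x y) x = sigma r (sigma r x y) (tau r y x)"
  using sigma_bij[of x] by (simp add: derived_def bij_betw_inv_into_left)

lemma derived_closed: "z \<in> X \<Longrightarrow> x \<in> X \<Longrightarrow> derived z x \<in> X"
  by (metis derived_sigma sigma_closed sigma_surj tau_closed)

text \<open>
  The second component of the Yang--Baxter equation rewrites the inner \<open>\<tau>\<close>, the first one moves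
  \<open>\<sigma>\<^sub>a\<close> across \<open>\<sigma>\<^sub>z\<close>.
\<close>

lemma sigma_derived:
  assumes "a \<in> X" "z \<in> X" "x \<in> X"
  shows "sigma r a (derived z x) = derived (sigma r a z) (sigma r a x)"
proof -
  obtain y where y: "y \<in> X" "z = sigma r x y" using assms sigma_surj by metis
  let ?y' = "sigma r (tau r x a) y" and ?z' = "sigma r a z"
  have z': "?z' = sigma r (sigma r a x) ?y'" using assms y yang_baxter(1)[of a x y] by simp
  have "sigma r a (derived z x) = sigma r a (sigma r z (tau r y x))"
    using assms y by (simp add: derived_sigma)
  also have "\<dots> = sigma r ?z' (sigma r (tau r z a) (tau r y x))"
    using assms y by (intro yang_baxter(1)) (simp_all add: tau_closed sigma_closed)
  also have "\<dots> = sigma r ?z' (tau r ?y' (sigma r a x))"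
    using assms y yang_baxter(2)[of a x y] by simp
  also have "\<dots> = derived ?z' (sigma r a x)"
    using assms y unfolding z' by (simp add: derived_sigma sigma_closed tau_closed)
  finally show ?thesis .
qed

text \<open>
  If \<open>\<sigma>\<^sub>u v = u\<close>, then \<open>\<tau>\<^sub>v u\<close> depends on \<open>v\<close> only: as \<open>\<sigma>\<^sub>u\<close> preserves \<open>derived\<close>, it maps both
  \<open>\<tau>\<^sub>v u\<close> and \<open>derived v v\<close> to \<open>derived u u\<close>. Then \<open>u\<close> is determined because \<open>\<tau>\<^sub>v\<close> is injective.
\<close>

lemma diagonal_unique:
  assumes "u \<in> X" "u' \<in> X" "v \<in> X" "sigma r u v = u" "sigma r u' v = u'"
  shows "u = u'"
proof -
  have tau: "tau r v w = derived v v" if w: "w \<in> X" "sigma r w v = w" for w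
  proof (rule sigma_inj)
    have "sigma r w (tau r v w) = derived w w"
      using derived_sigma[of w v] w assms(3) by simp
    also have "\<dots> = sigma r w (derived v v)"
      using sigma_derived[of w v v] w assms(3) by simp
    finally show "sigma r w (tau r v w) = sigma r w (derived v v)" .
  qed (use w assms(3) in \<open>simp_all add: tau_closed derived_closed\<close>)
  show ?thesis
    using tau[of u] tau[of u'] tau_bij[of v] assms by (metis bij_betw_inv_into_left)
qed

text \<open>
  Take \<open>p\<close> with \<open>\<tau>\<^sub>v p = v\<close> and put \<open>u = \<sigma>\<^sub>p v\<close>. Then \<open>\<sigma>\<^sub>p \<sigma>\<^sub>v = \<sigma>\<^sub>u \<sigma>\<^sub>v\<close>, so \<open>\<sigma>\<^sub>p = \<sigma>\<^sub>u\<close>.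
\<close>

lemma diagonal_exists:
  assumes v: "v \<in> X"
  obtains u where "u \<in> X" "sigma r u v = u"
proof -
  obtain p where p: "p \<in> X" "tau r v p = v"
    using tau_bij[OF v] v unfolding bij_betw_def by (metis imageE)
  let ?u = "sigma r p v"
  obtain t where t: "t \<in> X" "v = sigma r v t" using v sigma_surj by metis
  have "sigma r ?u v = sigma r p v"
    using yang_baxter(1)[OF p(1) v t(1)] p(2) t(2) by simp
  with that[of ?u] show thesis using p v by (simp add: sigma_closed)
qed


section \<open>The enveloping group and the derived group\<close>

abbreviation \<open>env \<equiv> enveloping_relations X r\<close>

abbreviation \<open>G \<equiv> presented_group X env\<close>

abbreviation \<open>\<iota> \<equiv> presented_generator X env\<close>

text \<open>
  A presentation of the additive group of the brace with reversed multiplication. The reversal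
  lets \<open>A\<close> act from the left on \<open>G\<close>, where \<open>\<eta> x\<close> acts by right addition of \<open>\<iota> x\<close>.
\<close>

definition derived_relations :: "('a word \<times> 'a word) set" where
  "derived_relations =
     {([(z, True), (x, True)], [(derived z x, True), (z, True)]) | z x. z \<in> X \<and> x \<in> X}"

abbreviation \<open>A \<equiv> presented_group X derived_relations\<close>

abbreviation \<open>\<eta> \<equiv> presented_generator X derived_relations\<close>

sublocale G: group G
  by (rule group_presented_group)

sublocale A: group A
  by (rule group_presented_group)

lemma \<iota>_closed: "x \<in> X \<Longrightarrow> \<iota> x \<in> carrier G"
  by (rule presented_generator_closed)

lemma \<eta>_closed: "x \<in> X \<Longrightarrow> \<eta> x \<in> carrier A"
  by (rule presented_generator_closed)

lemma enveloping_relation: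
  assumes "x \<in> X" "y \<in> X"
  shows "\<iota> x \<otimes>\<^bsub>G\<^esub> \<iota> y = \<iota> (sigma r x y) \<otimes>\<^bsub>G\<^esub> \<iota> (tau r y x)"
proof -
  have "([(x, True), (y, True)], [(sigma r x y, True), (tau r y x, True)]) \<in> env"
    using assms by (auto simp: enveloping_relations_def)
  then have "([(x, True), (y, True)], [(sigma r x y, True), (tau r y x, True)])
      \<in> presentation_cong X env"
    using presentation_cong.relation[of "[]" X "[]"] assms by (simp add: sigma_closed tau_closed)
  from presented_class_cong[OF this] show ?thesis
    using assms by (simp add: presented_group_mult sigma_closed tau_closed)
qed

lemma derived_relation:
  assumes "z \<in> X" "x \<in> X"
  shows "\<eta> z \<otimes>\<^bsub>A\<^esub> \<eta> x = \<eta> (derived z x) \<otimes>\<^bsub>A\<^esub> \<eta> z"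
proof -
  have "([(z, True), (x, True)], [(derived z x, True), (z, True)]) \<in> derived_relations"
    using assms by (auto simp: derived_relations_def)
  then have "([(z, True), (x, True)], [(derived z x, True), (z, True)])
      \<in> presentation_cong X derived_relations"
    using presentation_cong.relation[of "[]" X "[]"] assms by (simp add: derived_closed)
  from presented_class_cong[OF this] show ?thesis
    using assms by (simp add: presented_group_mult derived_closed)
qed

sublocale lam: generator_action X env X "sigma r"
proof
  show "word_act X (sigma r) p s = word_act X (sigma r) q s" if "(p, q) \<in> env" "s \<in> X" for p q s
    using that by (auto simp: enveloping_relations_def intro: yang_baxter(1))
qed (rule sigma_bij)

lemma lam_mult_generator:
  "\<lbrakk>g \<in> carrier G; x \<in> X; y \<in> X\<rbrakk> \<Longrightarrow> lam.\<Phi> (g \<otimes>\<^bsub>G\<^esub> \<iota> x) y = lam.\<Phi> g (sigma r x y)"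
  by (simp add: lam.act_mult \<iota>_closed lam.act_generator)

lemma lam_derived:
  assumes "g \<in> carrier G" "z \<in> X" "x \<in> X"
  shows "lam.\<Phi> g (derived z x) = derived (lam.\<Phi> g z) (lam.\<Phi> g x)"
  using assms
proof (induction g arbitrary: z x rule: presented_group_induct_left)
  case one
  then show ?case by (simp add: lam.act_one derived_closed)
next
  case (step a g)
  have "lam.\<Phi> (\<iota> a \<otimes>\<^bsub>G\<^esub> g) (derived z x) = derived (lam.\<Phi> (\<iota> a \<otimes>\<^bsub>G\<^esub> g) z) (lam.\<Phi> (\<iota> a \<otimes>\<^bsub>G\<^esub> g) x)
      \<longleftrightarrow> lam.\<Phi> g (derived z x) = derived (lam.\<Phi> g z) (lam.\<Phi> g x)" if "z \<in> X" "x \<in> X" for z x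
    using step(1,2) that sigma_inj[of a]
    by (auto simp: lam.act_mult \<iota>_closed lam.act_generator lam.act_closed derived_closed
        sigma_derived[symmetric])
  then show ?case by blast
qed


section \<open>The bijective cocycle\<close>

text \<open>
  For \<open>p = \<sigma>\<^sub>a\<close>, applying this also to the inverse permutation shows that the endomorphism is
  bijective (\<open>sigma_hat_bij\<close>).
\<close>

lemma derived_endomorphism_exists:
  assumes p: "bij_betw p X X"
    and pd: "\<And>z x. \<lbrakk>z \<in> X; x \<in> X\<rbrakk> \<Longrightarrow> p (derived z x) = derived (p z) (p x)"
  shows "\<exists>\<phi> \<in> hom A A. \<forall>x \<in> X. \<phi> (\<eta> x) = \<eta> (p x)"
proof (rule presented_group_hom_exists[OF A.is_group])
  note p_closed = bij_betw_apply[OF p]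
  show "\<eta> (p x) \<in> carrier A" if "x \<in> X" for x using that p_closed by (simp add: \<eta>_closed)
  fix u v assume "(u, v) \<in> derived_relations"
  then obtain z x where zx: "z \<in> X" "x \<in> X"
    and u: "u = [(z, True), (x, True)]" and v: "v = [(derived z x, True), (z, True)]"
    by (auto simp: derived_relations_def)
  have "\<eta> (p z) \<otimes>\<^bsub>A\<^esub> \<eta> (p x) = \<eta> (p (derived z x)) \<otimes>\<^bsub>A\<^esub> \<eta> (p z)"
    using derived_relation[of "p z" "p x"] zx p_closed by (simp add: pd)
  then show "\<exists>a \<in> X. \<exists>b \<in> X. \<exists>a' \<in> X. \<exists>b' \<in> X. u = [(a, True), (b, True)] \<and>
      v = [(a', True), (b', True)] \<and> \<eta> (p a) \<otimes>\<^bsub>A\<^esub> \<eta> (p b) = \<eta> (p a') \<otimes>\<^bsub>A\<^esub> \<eta> (p b')"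
    using zx u v derived_closed by blast
qed

definition sigma_hat :: "'a \<Rightarrow> 'a word set \<Rightarrow> 'a word set" where
  "sigma_hat a = (SOME \<phi>. \<phi> \<in> hom A A \<and> (\<forall>x \<in> X. \<phi> (\<eta> x) = \<eta> (sigma r a x)))"

lemma sigma_hat:
  assumes "a \<in> X"
  shows "sigma_hat a \<in> hom A A" and "x \<in> X \<Longrightarrow> sigma_hat a (\<eta> x) = \<eta> (sigma r a x)"
proof -
  have "\<exists>\<phi>. \<phi> \<in> hom A A \<and> (\<forall>x \<in> X. \<phi> (\<eta> x) = \<eta> (sigma r a x))"
    using derived_endomorphism_exists[OF sigma_bij[OF assms] sigma_derived[OF assms]] by blast
  from someI_ex[OF this, folded sigma_hat_def]
  show "sigma_hat a \<in> hom A A" and "x \<in> X \<Longrightarrow> sigma_hat a (\<eta> x) = \<eta> (sigma r a x)" by blast+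
qed

lemma sigma_hat_closed: "a \<in> X \<Longrightarrow> u \<in> carrier A \<Longrightarrow> sigma_hat a u \<in> carrier A"
  using sigma_hat(1)[of a] by (auto simp: hom_def)

lemma sigma_hat_mult:
  "a \<in> X \<Longrightarrow> u \<in> carrier A \<Longrightarrow> v \<in> carrier A \<Longrightarrow>
    sigma_hat a (u \<otimes>\<^bsub>A\<^esub> v) = sigma_hat a u \<otimes>\<^bsub>A\<^esub> sigma_hat a v"
  using sigma_hat(1)[of a] by (auto simp: hom_def)

lemma sigma_hat_bij:
  assumes a: "a \<in> X"
  shows "bij_betw (sigma_hat a) (carrier A) (carrier A)"
proof -
  let ?p = "inv_into X (sigma r a)"
  have p_closed: "?p x \<in> X" and p: "sigma r a (?p x) = x" "?p (sigma r a x) = x" if "x \<in> X" for x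
    using sigma_bij[OF a] that
    by (simp_all add: bij_betw_inv_into_left bij_betw_inv_into_right
        bij_betw_apply[OF bij_betw_inv_into])
  have "?p (derived z x) = derived (?p z) (?p x)" if "z \<in> X" "x \<in> X" for z x
    by (rule sigma_inj[of a]) (use that a in \<open>simp_all add: sigma_derived p p_closed derived_closed\<close>)
  from derived_endomorphism_exists[OF bij_betw_inv_into[OF sigma_bij[OF a]] this]
  obtain \<psi> where \<psi>: "\<psi> \<in> hom A A" "\<And>x. x \<in> X \<Longrightarrow> \<psi> (\<eta> x) = \<eta> (?p x)" by blast
  have id: "(\<lambda>u. u) \<in> hom A A" by (simp add: hom_def)
  \<comment> \<open>Both composites fix the generators of \<open>A\<close>.\<close>
  have "\<psi> (sigma_hat a u) = u" if "u \<in> carrier A" for u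
    using presented_group_hom_unique[OF A.is_group hom_compose[OF sigma_hat(1)[OF a] \<psi>(1)] id _ that]
    by (simp add: sigma_hat(2) a \<psi>(2) sigma_closed p)
  moreover have "sigma_hat a (\<psi> u) = u" if "u \<in> carrier A" for u
    using presented_group_hom_unique[OF A.is_group hom_compose[OF \<psi>(1) sigma_hat(1)[OF a]] id _ that]
    by (simp add: sigma_hat(2) a \<psi>(2) p_closed p)
  moreover have "\<psi> u \<in> carrier A" if "u \<in> carrier A" for u
    using \<psi>(1) that by (auto simp: hom_def)
  ultimately show ?thesis
    using a by (intro bij_betw_byWitness[where f' = \<psi>]) (auto simp: sigma_hat_closed)
qed

lemma sigma_hat_sigma_hat:
  assumes "x \<in> X" "y \<in> X" "u \<in> carrier A"
  shows "sigma_hat x (sigma_hat y u) = sigma_hat (sigma r x y) (sigma_hat (tau r y x) u)"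
proof -
  have hom: "sigma_hat b \<circ> sigma_hat c \<in> hom A A" if "b \<in> X" "c \<in> X" for b c
    using that by (intro hom_compose[OF sigma_hat(1) sigma_hat(1)])
  show ?thesis
    using presented_group_hom_unique[OF A.is_group hom[OF assms(1,2)]
        hom[of "sigma r x y" "tau r y x"] _ assms(3)] assms(1,2) yang_baxter(1)[of x y]
    by (simp add: sigma_hat(2) sigma_closed tau_closed)
qed

sublocale aut: generator_action X env "carrier A" sigma_hat
proof
  show "word_act (carrier A) sigma_hat p u = word_act (carrier A) sigma_hat q u"
    if "(p, q) \<in> env" "u \<in> carrier A" for p q u
    using that by (auto simp: enveloping_relations_def sigma_hat_sigma_hat[symmetric])
qed (rule sigma_hat_bij)

text \<open>
  This is the homomorphism from \<open>G\<close> to the holomorph of \<open>A\<close> that sends \<open>x\<close> to the affine map with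
  linear part \<open>\<sigma>\<^sub>x\<close> and translation part \<open>x\<close>. The relation \<open>x y = \<sigma>\<^sub>x(y) \<tau>\<^sub>y(x)\<close> of \<open>G\<close> turns into the
  relation of \<open>A\<close> between \<open>\<sigma>\<^sub>x(y)\<close> and \<open>x\<close>.
\<close>

sublocale aff: generator_action X env "carrier A" "\<lambda>x u. sigma_hat x u \<otimes>\<^bsub>A\<^esub> \<eta> x"
proof
  show "bij_betw (\<lambda>u. sigma_hat x u \<otimes>\<^bsub>A\<^esub> \<eta> x) (carrier A) (carrier A)" if "x \<in> X" for x
  proof -
    have "bij_betw (\<lambda>u. u \<otimes>\<^bsub>A\<^esub> \<eta> x) (carrier A) (carrier A)"
      using \<eta>_closed[OF that]
      by (intro bij_betw_byWitness[where f' = "\<lambda>u. u \<otimes>\<^bsub>A\<^esub> inv\<^bsub>A\<^esub> \<eta> x"]) (auto simp: A.m_assoc)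
    from bij_betw_trans[OF sigma_hat_bij[OF that] this] show ?thesis by (simp add: comp_def)
  qed
  fix p q u assume "(p, q) \<in> env" and u: "u \<in> carrier A"
  then obtain x y where xy: "x \<in> X" "y \<in> X"
    and p: "p = [(x, True), (y, True)]" and q: "q = [(sigma r x y, True), (tau r y x, True)]"
    by (auto simp: enveloping_relations_def)
  let ?z = "sigma r x y" and ?t = "tau r y x"
  have zt: "?z \<in> X" "?t \<in> X" using xy by (simp_all add: sigma_closed tau_closed)
  have "sigma_hat x (sigma_hat y u \<otimes>\<^bsub>A\<^esub> \<eta> y) \<otimes>\<^bsub>A\<^esub> \<eta> x =
      sigma_hat x (sigma_hat y u) \<otimes>\<^bsub>A\<^esub> (\<eta> ?z \<otimes>\<^bsub>A\<^esub> \<eta> x)"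
    using xy zt u by (simp add: sigma_hat_mult sigma_hat_closed \<eta>_closed sigma_hat(2) A.m_assoc)
  also have "\<dots> = sigma_hat ?z (sigma_hat ?t u) \<otimes>\<^bsub>A\<^esub> (\<eta> (sigma r ?z ?t) \<otimes>\<^bsub>A\<^esub> \<eta> ?z)"
    using xy derived_relation[OF zt(1) xy(1)] derived_sigma[OF xy] sigma_hat_sigma_hat[OF xy u]
    by simp
  also have "\<dots> = sigma_hat ?z (sigma_hat ?t u \<otimes>\<^bsub>A\<^esub> \<eta> ?t) \<otimes>\<^bsub>A\<^esub> \<eta> ?z"
    using zt u
    by (simp add: sigma_hat_mult sigma_hat_closed \<eta>_closed sigma_hat(2) A.m_assoc sigma_closed)
  finally show "word_act (carrier A) (\<lambda>x u. sigma_hat x u \<otimes>\<^bsub>A\<^esub> \<eta> x) p u =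
      word_act (carrier A) (\<lambda>x u. sigma_hat x u \<otimes>\<^bsub>A\<^esub> \<eta> x) q u"
    by (simp add: p q)
qed

definition cocycle :: "'a word set \<Rightarrow> 'a word set" where
  "cocycle g = aff.\<Phi> g \<one>\<^bsub>A\<^esub>"

lemma cocycle_closed: "g \<in> carrier G \<Longrightarrow> cocycle g \<in> carrier A"
  by (simp add: cocycle_def aff.act_closed)

lemma aut_hom:
  assumes "g \<in> carrier G"
  shows "aut.\<Phi> g \<in> hom A A"
proof (rule homI)
  show "aut.\<Phi> g u \<in> carrier A" if "u \<in> carrier A" for u
    using assms that by (rule aut.act_closed)
  show "aut.\<Phi> g (u \<otimes>\<^bsub>A\<^esub> v) = aut.\<Phi> g u \<otimes>\<^bsub>A\<^esub> aut.\<Phi> g v"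
    if uv: "u \<in> carrier A" "v \<in> carrier A" for u v
    using assms
  proof (induction g rule: presented_group_induct_left)
    case one
    then show ?case using uv by (simp add: aut.act_one)
  next
    case (step x g)
    then show ?case
      using uv bij_betw_imp_inj_on[OF sigma_hat_bij[of x]]
      by (simp add: aut.act_mult \<iota>_closed aut.act_generator aut.act_closed
          sigma_hat_mult[symmetric] inj_on_eq_iff)
  qed
qed

lemma aut_generator:
  assumes "g \<in> carrier G" "x \<in> X"
  shows "aut.\<Phi> g (\<eta> x) = \<eta> (lam.\<Phi> g x)"
  using assms(1)
proof (induction g rule: presented_group_induct_left)
  case one
  then show ?case using assms(2) by (simp add: aut.act_one lam.act_one \<eta>_closed)
next
  case (step y g)
  then show ?case
    using assms(2) bij_betw_imp_inj_on[OF sigma_hat_bij[of y]]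
    by (simp add: aut.act_mult lam.act_mult \<iota>_closed \<eta>_closed aut.act_generator lam.act_generator
        aut.act_closed lam.act_closed sigma_hat(2)[symmetric] inj_on_eq_iff)
qed

text \<open>
  The action on \<open>A\<close> is by affine maps: its linear part comes from \<open>\<sigma>\<close> and its translation part is the
  value at the neutral element. Hence \<open>cocycle\<close> is a 1-cocycle.
\<close>

lemma aff_eq:
  assumes "g \<in> carrier G" "u \<in> carrier A"
  shows "aff.\<Phi> g u = aut.\<Phi> g u \<otimes>\<^bsub>A\<^esub> cocycle g"
  using assms(1)
proof (induction g rule: presented_group_induct_left)
  case one
  then show ?case using assms(2) by (simp add: cocycle_def aff.act_one aut.act_one)
next
  case (step x g)
  have "aut.\<Phi> (\<iota> x \<otimes>\<^bsub>G\<^esub> g) u \<otimes>\<^bsub>A\<^esub> cocycle (\<iota> x \<otimes>\<^bsub>G\<^esub> g) =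
      aff.\<Phi> (\<iota> x) (aut.\<Phi> g u \<otimes>\<^bsub>A\<^esub> cocycle g)"
    using step(1,2) assms(2)
    by (simp add: cocycle_def aut.act_mult aff.act_mult \<iota>_closed aut.act_generator aff.act_generator
        aut.act_closed aff.act_closed sigma_hat_mult sigma_hat_closed \<eta>_closed A.m_assoc)
  moreover have "aff.\<Phi> (\<iota> x \<otimes>\<^bsub>G\<^esub> g) u = aff.\<Phi> (\<iota> x) (aff.\<Phi> g u)"
    using step(1,2) assms(2) by (simp add: aff.act_mult \<iota>_closed)
  ultimately show ?case
    using aff.act_inj[of "\<iota> x" "aff.\<Phi> g u" "aut.\<Phi> g u \<otimes>\<^bsub>A\<^esub> cocycle g"] step(1,2) assms(2)
    by (auto simp: \<iota>_closed aff.act_closed aut.act_closed cocycle_closed)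
qed

lemma cocycle_mult:
  "\<lbrakk>g \<in> carrier G; h \<in> carrier G\<rbrakk> \<Longrightarrow>
    cocycle (g \<otimes>\<^bsub>G\<^esub> h) = aut.\<Phi> g (cocycle h) \<otimes>\<^bsub>A\<^esub> cocycle g"
  using aff_eq[of g "cocycle h"] by (simp add: cocycle_def aff.act_mult aff.act_closed)

lemma cocycle_one: "cocycle \<one>\<^bsub>G\<^esub> = \<one>\<^bsub>A\<^esub>"
  by (simp add: cocycle_def aff.act_one)

lemma cocycle_generator: "x \<in> X \<Longrightarrow> cocycle (\<iota> x) = \<eta> x"
  using hom_one[OF sigma_hat(1)[of x] A.is_group A.is_group]
  by (simp add: cocycle_def aff.act_generator \<eta>_closed)

lemma cocycle_mult_generator:
  "\<lbrakk>g \<in> carrier G; x \<in> X\<rbrakk> \<Longrightarrow> cocycle (g \<otimes>\<^bsub>G\<^esub> \<iota> x) = \<eta> (lam.\<Phi> g x) \<otimes>\<^bsub>A\<^esub> cocycle g"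
  by (simp add: cocycle_mult \<iota>_closed cocycle_generator aut_generator)

text \<open>
  In the resulting brace this is the map \<open>g \<mapsto> g \<cdot> \<iota> x\<close>. It is mostly used in the form of
  \<open>translation_lam\<close>, which avoids the inverse.
\<close>

definition translation :: "'a \<Rightarrow> 'a word set \<Rightarrow> 'a word set" where
  "translation x g = g \<otimes>\<^bsub>G\<^esub> \<iota> (lam.\<Phi> (inv\<^bsub>G\<^esub> g) x)"

lemma translation_lam:
  "\<lbrakk>g \<in> carrier G; x \<in> X\<rbrakk> \<Longrightarrow> translation (lam.\<Phi> g x) g = g \<otimes>\<^bsub>G\<^esub> \<iota> x"
  by (simp add: translation_def lam.act_inv)

lemma lam_surj:
  assumes "g \<in> carrier G" "x \<in> X"
  obtains x' where "x' \<in> X" "x = lam.\<Phi> g x'"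
  using lam.act_inv(2)[OF assms] lam.act_closed[OF G.inv_closed[OF assms(1)] assms(2)] by metis

text \<open>
  To solve \<open>T\<^sub>x g = k\<close>, write \<open>k = g \<circ> \<iota> u\<close> with \<open>\<lambda>\<^sub>g u = x\<close>. Since \<open>\<lambda>\<^sub>k = \<lambda>\<^sub>g \<sigma>\<^sub>u\<close>, the letter \<open>u\<close> is
  the solution of \<open>\<sigma>\<^sub>u v = u\<close> for \<open>v = \<lambda>\<^sub>k\<inverse> x\<close>, and the diagonal lemmas give exactly one such \<open>u\<close>.
\<close>

lemma translation_bij:
  assumes x: "x \<in> X"
  shows "bij_betw (translation x) (carrier G) (carrier G)"
proof (rule bij_betw_imageI[OF inj_onI equalityI[OF image_subsetI subsetI]])
  fix g h assume g: "g \<in> carrier G" and h: "h \<in> carrier G" and eq: "translation x g = translation x h"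
  obtain u where u: "u \<in> X" "x = lam.\<Phi> g u" using lam_surj[OF g x] by metis
  obtain v where v: "v \<in> X" "x = lam.\<Phi> h v" using lam_surj[OF h x] by metis
  have k: "g \<otimes>\<^bsub>G\<^esub> \<iota> u = h \<otimes>\<^bsub>G\<^esub> \<iota> v"
    using eq translation_lam[OF g u(1)] translation_lam[OF h v(1)] u v by simp
  \<comment> \<open>\<open>a\<close> and \<open>b\<close> are the diagonal images of \<open>u\<close> and \<open>v\<close>; both are \<open>\<lambda>\<^sub>k\<inverse> x\<close> for the common value \<open>k\<close>.\<close>
  obtain a where a: "a \<in> X" "u = sigma r u a" using u(1) sigma_surj by metis
  obtain b where b: "b \<in> X" "v = sigma r v b" using v(1) sigma_surj by metis
  have "lam.\<Phi> (g \<otimes>\<^bsub>G\<^esub> \<iota> u) a = lam.\<Phi> (g \<otimes>\<^bsub>G\<^esub> \<iota> u) b"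
    using lam_mult_generator[OF g u(1) a(1)] lam_mult_generator[OF h v(1) b(1)] a(2) b(2) u(2) v(2) k
    by simp
  then have "a = b"
    by (rule lam.act_inj[rotated 3]) (use g u a b in \<open>simp_all add: \<iota>_closed\<close>)
  then have "u = v" using diagonal_unique[of u v a] u v a b by simp
  then show "g = h" using k g h u(1) by (simp add: \<iota>_closed)
next
  show "translation x g \<in> carrier G" if "g \<in> carrier G" for g
    using that x by (simp add: translation_def \<iota>_closed lam.act_closed)
next
  fix k assume k: "k \<in> carrier G"
  obtain v where v: "v \<in> X" "x = lam.\<Phi> k v" using lam_surj[OF k x] by metis
  obtain u where u: "u \<in> X" "sigma r u v = u" using diagonal_exists[OF v(1)] by metis
  let ?g = "k \<otimes>\<^bsub>G\<^esub> inv\<^bsub>G\<^esub> \<iota> u"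
  have g: "?g \<in> carrier G" and gu: "?g \<otimes>\<^bsub>G\<^esub> \<iota> u = k"
    using k u(1) by (simp_all add: \<iota>_closed G.m_assoc)
  have "lam.\<Phi> ?g u = x"
    using lam_mult_generator[OF g u(1) v(1)] u v gu by simp
  then have "translation x ?g = k" using translation_lam[OF g u(1)] gu by simp
  then show "k \<in> translation x ` carrier G" using g by blast
qed

text \<open>
  The relation of \<open>A\<close> for \<open>z = \<lambda>\<^sub>g(\<sigma>\<^bsub>x'\<^esub> y)\<close> and \<open>x = \<lambda>\<^sub>g(x')\<close>, evaluated at \<open>g\<close>, is the relation
  \<open>x' y = \<sigma>\<^bsub>x'\<^esub>(y) \<tau>\<^sub>y(x')\<close> of \<open>G\<close> multiplied by \<open>g\<close> on the left.
\<close>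

sublocale tr: generator_action X derived_relations "carrier G" translation
proof
  fix p q g assume "(p, q) \<in> derived_relations" and g: "g \<in> carrier G"
  then obtain z x where zx: "z \<in> X" "x \<in> X"
    and p: "p = [(z, True), (x, True)]" and q: "q = [(derived z x, True), (z, True)]"
    by (auto simp: derived_relations_def)
  obtain x' where x': "x' \<in> X" "x = lam.\<Phi> g x'" using lam_surj[OF g zx(2)] by metis
  obtain z' where z': "z' \<in> X" "z = lam.\<Phi> g z'" using lam_surj[OF g zx(1)] by metis
  obtain y where y: "y \<in> X" "z' = sigma r x' y" using sigma_surj[OF x'(1) z'(1)] by metis
  let ?t = "tau r y x'"
  have t: "?t \<in> X" using x' y by (simp add: tau_closed)
  have tx: "translation x g = g \<otimes>\<^bsub>G\<^esub> \<iota> x'" and tz: "translation z g = g \<otimes>\<^bsub>G\<^esub> \<iota> z'"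
    using translation_lam g x' z' by simp_all
  have gx: "g \<otimes>\<^bsub>G\<^esub> \<iota> x' \<in> carrier G" and gz: "g \<otimes>\<^bsub>G\<^esub> \<iota> z' \<in> carrier G"
    using g x'(1) z'(1) by (simp_all add: \<iota>_closed)
  have "translation z (translation x g) = g \<otimes>\<^bsub>G\<^esub> \<iota> x' \<otimes>\<^bsub>G\<^esub> \<iota> y"
    using translation_lam[OF gx y(1)] lam_mult_generator[OF g x'(1) y(1)] y(2) z'(2) tx by simp
  also have "\<dots> = g \<otimes>\<^bsub>G\<^esub> \<iota> z' \<otimes>\<^bsub>G\<^esub> \<iota> ?t"
    using g x'(1) z'(1) y t enveloping_relation[OF x'(1) y(1)] by (simp add: G.m_assoc \<iota>_closed)
  also have "\<dots> = translation (derived z x) (translation z g)"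
  proof -
    have "lam.\<Phi> (g \<otimes>\<^bsub>G\<^esub> \<iota> z') ?t = derived z x"
      using lam_mult_generator[OF g z'(1) t] derived_sigma[OF x'(1) y(1)] lam_derived[OF g z'(1) x'(1)]
        x'(2) z'(2) y(2) by simp
    then show ?thesis using translation_lam[OF gz t] tz by simp
  qed
  finally show "word_act (carrier G) translation p g = word_act (carrier G) translation q g"
    by (simp add: p q)
qed (rule translation_bij)

lemma cocycle_tr:
  assumes "u \<in> carrier A"
  shows "cocycle (tr.\<Phi> u \<one>\<^bsub>G\<^esub>) = u"
  using assms
proof (induction u rule: presented_group_induct_left)
  case one
  then show ?case by (simp add: tr.act_one cocycle_one)
next
  case (step x u)
  let ?g = "tr.\<Phi> u \<one>\<^bsub>G\<^esub>"
  have g: "?g \<in> carrier G" using step(2) by (simp add: tr.act_closed)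
  obtain x' where x': "x' \<in> X" "x = lam.\<Phi> ?g x'" using lam_surj[OF g step(1)] by metis
  have "tr.\<Phi> (\<eta> x \<otimes>\<^bsub>A\<^esub> u) \<one>\<^bsub>G\<^esub> = ?g \<otimes>\<^bsub>G\<^esub> \<iota> x'"
    using step(1,2) g translation_lam[OF g x'(1)] x'(2)
    by (simp add: tr.act_mult \<eta>_closed tr.act_generator)
  then have "cocycle (tr.\<Phi> (\<eta> x \<otimes>\<^bsub>A\<^esub> u) \<one>\<^bsub>G\<^esub>) = \<eta> x \<otimes>\<^bsub>A\<^esub> cocycle ?g"
    using cocycle_mult_generator[OF g x'(1)] x'(2) by simp
  then show ?case using step(1,2) g by (simp add: \<eta>_closed cocycle_closed)
qed

text \<open>
  Here the induction appends generators on the right: by \<open>cocycle_mult_generator\<close> the cocycle turns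
  \<open>\<circ>\<close>-multiplication by \<open>\<iota> x\<close> into left multiplication by a generator of \<open>A\<close>, and by \<open>translation_lam\<close>
  that generator again acts at \<open>g\<close> as right \<open>\<circ>\<close>-multiplication by \<open>\<iota> x\<close>.
\<close>

lemma tr_cocycle:
  assumes "g \<in> carrier G"
  shows "tr.\<Phi> (cocycle g) \<one>\<^bsub>G\<^esub> = g"
  using assms
proof (induction g rule: presented_group_induct_right)
  case one
  then show ?case by (simp add: tr.act_one cocycle_one)
next
  case (step x g)
  let ?z = "lam.\<Phi> g x" and ?h = "tr.\<Phi> (cocycle g) \<one>\<^bsub>G\<^esub>"
  have z: "?z \<in> X" and h: "?h \<in> carrier G"
    using step(1,2) by (simp_all add: lam.act_closed tr.act_closed cocycle_closed)
  have "tr.\<Phi> (cocycle (g \<otimes>\<^bsub>G\<^esub> \<iota> x)) \<one>\<^bsub>G\<^esub> = translation ?z ?h"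
    using step(1,2) z h
    by (simp add: cocycle_mult_generator tr.act_mult \<eta>_closed cocycle_closed tr.act_generator)
  moreover have "g \<otimes>\<^bsub>G\<^esub> \<iota> x = translation ?z g" using translation_lam[OF step(2,1)] by simp
  ultimately show ?case
    using bij_betw_imp_inj_on[OF translation_bij[OF z]] step(2) h by (simp add: inj_on_eq_iff)
qed

lemma cocycle_bij: "bij_betw cocycle (carrier G) (carrier A)"
  by (rule bij_betw_byWitness[where f' = "\<lambda>u. tr.\<Phi> u \<one>\<^bsub>G\<^esub>"])
    (auto simp: cocycle_tr tr_cocycle cocycle_closed tr.act_closed)


section \<open>The brace structure and its universal property\<close>

definition enveloping_dot :: "'a word set monoid" where
  "enveloping_dot = transported_group (carrier G) cocycle
     \<lparr>carrier = carrier A, mult = (\<lambda>u v. v \<otimes>\<^bsub>A\<^esub> u), one = \<one>\<^bsub>A\<^esub>\<rparr>"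

lemma enveloping_brace:
  shows "skew_left_brace enveloping_dot G"
    and "\<lbrakk>g \<in> carrier G; h \<in> carrier G\<rbrakk> \<Longrightarrow>
      cocycle (brace_lambda enveloping_dot G g h) = aut.\<Phi> g (cocycle h)"
proof -
  let ?A = "\<lparr>carrier = carrier A, mult = (\<lambda>u v. v \<otimes>\<^bsub>A\<^esub> u), one = \<one>\<^bsub>A\<^esub>\<rparr>"
  have hom: "aut.\<Phi> g \<in> hom ?A ?A" if "g \<in> carrier G" for g
    using aut_hom[OF that] by (auto simp: hom_def)
  have bij: "bij_betw cocycle (carrier G) (carrier ?A)"
    using cocycle_bij by simp
  have coc: "cocycle (g \<otimes>\<^bsub>G\<^esub> h) = cocycle g \<otimes>\<^bsub>?A\<^esub> aut.\<Phi> g (cocycle h)"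
    if "g \<in> carrier G" "h \<in> carrier G" for g h
    using cocycle_mult[OF that] by simp
  note * = skew_left_brace_of_bijective_cocycle[where \<Lambda> = aut.\<Phi>,
      OF G.is_group opposite_group[OF A.is_group] bij hom coc, folded enveloping_dot_def]
  show "skew_left_brace enveloping_dot G"
    by (rule *(1))
  show "\<lbrakk>g \<in> carrier G; h \<in> carrier G\<rbrakk> \<Longrightarrow>
      cocycle (brace_lambda enveloping_dot G g h) = aut.\<Phi> g (cocycle h)"
    by (rule *(2))
qed

lemma enveloping_brace_intertwines: "intertwines X \<iota> r (brace_solution enveloping_dot G)"
proof -
  interpret B: skew_left_brace enveloping_dot G by (rule enveloping_brace)
  have "map_prod \<iota> \<iota> (r (x, y)) = brace_solution enveloping_dot G (\<iota> x, \<iota> y)"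
    if xy: "x \<in> X" "y \<in> X" for x y
  proof -
    have r: "r (x, y) = (sigma r x y, tau r y x)" by (simp add: sigma_def tau_def)
    have i: "\<iota> x \<in> carrier enveloping_dot" "\<iota> y \<in> carrier enveloping_dot"
      using xy by (simp_all add: B.same_carrier \<iota>_closed)
    have "cocycle (brace_lambda enveloping_dot G (\<iota> x) (\<iota> y)) = cocycle (\<iota> (sigma r x y))"
      using xy enveloping_brace(2)[of "\<iota> x" "\<iota> y"]
      by (simp add: \<iota>_closed cocycle_generator sigma_closed aut.act_generator \<eta>_closed sigma_hat(2))
    then have "brace_lambda enveloping_dot G (\<iota> x) (\<iota> y) = \<iota> (sigma r x y)"
      using bij_betw_imp_inj_on[OF cocycle_bij] B.lambda_closed[OF i] xy
      by (simp add: inj_on_eq_iff B.same_carrier \<iota>_closed sigma_closed)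
    moreover have "\<iota> (tau r y x) = inv\<^bsub>G\<^esub> \<iota> (sigma r x y) \<otimes>\<^bsub>G\<^esub> (\<iota> x \<otimes>\<^bsub>G\<^esub> \<iota> y)"
      using enveloping_relation[OF xy] xy
      by (simp add: \<iota>_closed sigma_closed tau_closed G.m_assoc[symmetric])
    ultimately show ?thesis using i by (simp add: r B.brace_solution_eq)
  qed
  then show ?thesis by (auto simp: intertwines_def)
qed

text \<open>
  On the images of \<open>X\<close> the maps \<open>\<lambda>\<^sub>g\<close> of \<open>G\<close> and \<open>\<lambda>\<^bsub>\<phi> g\<^esub>\<close> of the target both follow the action of
  \<open>g\<close> on \<open>X\<close>. Hence \<open>g \<cdot> \<iota> x\<close> and \<open>\<phi> g \<cdot> f x\<close> are the \<open>\<circ>\<close>-products of \<open>g\<close> with \<open>\<iota> y\<close> and of \<open>\<phi> g\<close>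
  with \<open>f y\<close>, for the same \<open>y\<close>, so \<open>\<phi>\<close> respects the addition of one generator. Any element of \<open>G\<close>
  is reached from the neutral one by adding and subtracting generators. Stated for
  any intertwining brace structure on \<open>G\<close>, the lemma also compares two of them.
\<close>

lemma intertwining_hom_is_brace_hom:
  assumes "skew_left_brace D G" and \<iota>: "intertwines X \<iota> r (brace_solution D G)"
    and "skew_left_brace BD BC" and f: "intertwines X f r (brace_solution BD BC)"
    and \<phi>: "\<phi> \<in> hom G BC" and \<phi>f: "\<And>x. x \<in> X \<Longrightarrow> \<phi> (\<iota> x) = f x"
  shows "\<phi> \<in> hom D BD"
proof -
  interpret D: skew_left_brace D G by fact
  interpret B: skew_left_brace BD BC by fact
  interpret \<phi>: group_hom G BC \<phi>
    by (rule group_hom.intro) (auto simp: group_hom_axioms_def \<phi> G.is_group B.circ.is_group)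
  let ?l = "brace_lambda D G" and ?m = "brace_lambda BD BC"
  have c: "carrier D = carrier G" "carrier BD = carrier BC"
    by (rule D.same_carrier B.same_carrier)+
  have \<phi>_closed: "\<phi> g \<in> carrier BD" if "g \<in> carrier D" for g using that by (simp add: c)
  have i: "\<iota> x \<in> carrier D" if "x \<in> X" for x
    unfolding c by (rule \<iota>_closed[OF that])
  have fx: "f x \<in> carrier BD" if "x \<in> X" for x
    using \<phi>_closed[OF i[OF that]] unfolding \<phi>f[OF that] .
  have l: "?l (\<iota> x) (\<iota> y) = \<iota> (sigma r x y)" and m: "?m (f x) (f y) = f (sigma r x y)"
    if xy: "x \<in> X" "y \<in> X" for x y
  proof -
    have "map_prod \<iota> \<iota> (r (x, y)) = brace_solution D G (\<iota> x, \<iota> y)"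
      and "map_prod f f (r (x, y)) = brace_solution BD BC (f x, f y)"
      using \<iota> f xy by (auto simp: intertwines_def)
    then show "?l (\<iota> x) (\<iota> y) = \<iota> (sigma r x y)" and "?m (f x) (f y) = f (sigma r x y)"
      by (simp_all add: brace_solution_def sigma_def map_prod_def split_beta)
  qed
  have lam: "?l g (\<iota> x) = \<iota> (lam.\<Phi> g x) \<and> ?m (\<phi> g) (f x) = f (lam.\<Phi> g x)"
    if g: "g \<in> carrier G" and x: "x \<in> X" for g x
    using g
  proof (induction g rule: presented_group_induct_left)
    case one
    then show ?case using x i fx by (simp add: D.lambda_one B.lambda_one lam.act_one)
  next
    case (step y g)
    have g: "g \<in> carrier D" "\<phi> g \<in> carrier BD" using step(2) by (simp_all add: c)
    let ?x = "lam.\<Phi> g x"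
    have x': "?x \<in> X" using step(2) x by (rule lam.act_closed)
    have "?l (\<iota> y \<otimes>\<^bsub>G\<^esub> g) (\<iota> x) = ?l (\<iota> y) (?l g (\<iota> x))"
      by (rule D.lambda_circ) (simp_all add: g i x step(1))
    moreover have "?m (\<phi> (\<iota> y \<otimes>\<^bsub>G\<^esub> g)) (f x) = ?m (f y) (?m (\<phi> g) (f x))"
      using B.lambda_circ[of "f y" "\<phi> g" "f x"] \<phi>.hom_mult[OF \<iota>_closed[OF step(1)] step(2)]
        \<phi>f[OF step(1)] g(2) fx[OF x] fx[OF step(1)] by simp
    moreover have "lam.\<Phi> (\<iota> y \<otimes>\<^bsub>G\<^esub> g) x = sigma r y ?x"
      using step(1,2) x x' by (simp add: lam.act_mult \<iota>_closed lam.act_generator)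
    moreover have "?l (\<iota> y) (?l g (\<iota> x)) = \<iota> (sigma r y ?x) \<longleftrightarrow> ?l g (\<iota> x) = \<iota> ?x"
      using l[OF step(1) x'] D.lambda_inj[of "\<iota> y" "?l g (\<iota> x)" "\<iota> ?x"] i step(1) x x' g
        D.lambda_closed by metis
    moreover have "?m (f y) (?m (\<phi> g) (f x)) = f (sigma r y ?x) \<longleftrightarrow> ?m (\<phi> g) (f x) = f ?x"
      using m[OF step(1) x'] B.lambda_inj[of "f y" "?m (\<phi> g) (f x)" "f ?x"] fx step(1) x x' g
        B.lambda_closed by metis
    ultimately show ?case by simp
  qed
  have gen: "\<phi> (g \<otimes>\<^bsub>D\<^esub> \<iota> x) = \<phi> g \<otimes>\<^bsub>BD\<^esub> f x" if g: "g \<in> carrier G" and x: "x \<in> X" for g x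
  proof -
    obtain y where y: "y \<in> X" "x = lam.\<Phi> g y" using lam_surj[OF g x] by metis
    have "g \<otimes>\<^bsub>D\<^esub> \<iota> x = g \<otimes>\<^bsub>G\<^esub> \<iota> y"
      using D.circ_eq_dot_lambda[of g "\<iota> y"] lam[OF g y(1)] g i[OF y(1)] y(2) by (simp add: c)
    moreover have "\<phi> g \<otimes>\<^bsub>BD\<^esub> f x = \<phi> g \<otimes>\<^bsub>BC\<^esub> f y"
      using B.circ_eq_dot_lambda[of "\<phi> g" "f y"] lam[OF g y(1)] g fx[OF y(1)] y(2) by (simp add: c)
    ultimately show ?thesis using g y(1) by (simp add: \<iota>_closed \<phi>f)
  qed
  have "\<phi> (g \<otimes>\<^bsub>D\<^esub> h) = \<phi> g \<otimes>\<^bsub>BD\<^esub> \<phi> h" if g: "g \<in> carrier G" and h: "h \<in> carrier G" for g h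
    using h
  proof (induction h rule: presented_group_induct_right)
    case one
    then show ?case
      using g \<phi>_closed[of g] \<phi>.hom_one by (simp add: D.one_eq B.one_eq c[symmetric])
  next
    case (step x h)
    let ?x = "lam.\<Phi> h x"
    have x': "?x \<in> X" using step(2,1) by (rule lam.act_closed)
    have gD: "g \<in> carrier D" "h \<in> carrier D" using g step(2) by (simp_all add: c)
    have gh: "g \<otimes>\<^bsub>D\<^esub> h \<in> carrier G" using D.dot.m_closed[OF gD] by (simp add: c)
    have hx: "h \<otimes>\<^bsub>G\<^esub> \<iota> x = h \<otimes>\<^bsub>D\<^esub> \<iota> ?x"
      using D.circ_eq_dot_lambda[OF gD(2) i[OF step(1)]] lam[OF step(2,1)] by simp
    have "\<phi> (g \<otimes>\<^bsub>D\<^esub> (h \<otimes>\<^bsub>G\<^esub> \<iota> x)) = \<phi> (g \<otimes>\<^bsub>D\<^esub> h) \<otimes>\<^bsub>BD\<^esub> f ?x"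
      using gen[OF gh x'] D.dot.m_assoc[OF gD i[OF x']] hx by simp
    moreover have "\<phi> g \<otimes>\<^bsub>BD\<^esub> \<phi> (h \<otimes>\<^bsub>G\<^esub> \<iota> x) = \<phi> g \<otimes>\<^bsub>BD\<^esub> \<phi> h \<otimes>\<^bsub>BD\<^esub> f ?x"
      using gen[OF step(2) x'] hx gD x' by (simp add: B.dot.m_assoc \<phi>_closed fx)
    moreover have "\<phi> (g \<otimes>\<^bsub>D\<^esub> h) \<in> carrier BD" using gh by (simp add: c)
    ultimately show ?case using \<phi>_closed gD fx[OF x'] by simp
  qed
  then show ?thesis by (intro homI) (simp_all add: c)
qed

text \<open>
  By \<open>brace_solution_eq\<close> the two components of the solution of a brace at \<open>(a, b)\<close> have \<open>\<circ>\<close>-product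
  \<open>a \<circ> b\<close>, so \<open>f\<close> respects the relations of the enveloping group.
\<close>

lemma enveloping_hom_exists:
  assumes "skew_left_brace BD BC" and f_closed: "f \<in> X \<rightarrow> carrier BC"
    and f: "intertwines X f r (brace_solution BD BC)"
  shows "\<exists>\<phi> \<in> hom G BC. \<forall>x \<in> X. \<phi> (\<iota> x) = f x"
proof (rule presented_group_hom_exists)
  interpret B: skew_left_brace BD BC by fact
  show "group BC" by (rule B.circ.is_group)
  show fx: "f x \<in> carrier BC" if "x \<in> X" for x using f_closed that by blast
  fix p q assume "(p, q) \<in> env"
  then obtain x y where xy: "x \<in> X" "y \<in> X"
    and p: "p = [(x, True), (y, True)]" and q: "q = [(sigma r x y, True), (tau r y x, True)]"
    by (auto simp: enveloping_relations_def)
  have fD: "f x \<in> carrier BD" "f y \<in> carrier BD" using fx xy by (simp_all add: B.same_carrier)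
  have "map_prod f f (r (x, y)) = brace_solution BD BC (f x, f y)"
    using f xy by (auto simp: intertwines_def)
  then have s: "f (sigma r x y) = brace_lambda BD BC (f x) (f y)"
    and t: "f (tau r y x) = inv\<^bsub>BC\<^esub> (brace_lambda BD BC (f x) (f y)) \<otimes>\<^bsub>BC\<^esub> (f x \<otimes>\<^bsub>BC\<^esub> f y)"
    using fD by (simp_all add: B.brace_solution_eq sigma_def tau_def map_prod_def split_beta)
  have "f x \<otimes>\<^bsub>BC\<^esub> f y = f (sigma r x y) \<otimes>\<^bsub>BC\<^esub> f (tau r y x)"
    using fx[OF xy(1)] fx[OF xy(2)] fx[OF sigma_closed[OF xy]]
    unfolding t s by (simp add: B.circ.m_assoc[symmetric])
  then show "\<exists>a \<in> X. \<exists>b \<in> X. \<exists>a' \<in> X. \<exists>b' \<in> X. p = [(a, True), (b, True)] \<and>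
      q = [(a', True), (b', True)] \<and> f a \<otimes>\<^bsub>BC\<^esub> f b = f a' \<otimes>\<^bsub>BC\<^esub> f b'"
    using xy p q sigma_closed tau_closed by blast
qed

end

theorem theorem3p9:
  fixes X :: "'a set" and r :: "'a \<times> 'a \<Rightarrow> 'a \<times> 'a"
    and G :: "'a word set monoid" and \<iota> :: "'a \<Rightarrow> 'a word set"
  assumes "yang_baxter_solution X r" and "nondegenerate X r"
    and "G = enveloping_group X r" and "\<iota> = enveloping_map X r"
  shows "\<exists>D :: 'a word set monoid.
      (skew_left_brace D G \<and> intertwines X \<iota> r (brace_solution D G)) \<and>
      (\<forall>D' :: 'a word set monoid.
         skew_left_brace D' G \<and> intertwines X \<iota> r (brace_solution D' G) \<longrightarrow>
         (\<forall>a \<in> carrier G. \<forall>b \<in> carrier G. a \<otimes>\<^bsub>D'\<^esub> b = a \<otimes>\<^bsub>D\<^esub> b)) \<and>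
      (\<forall>(BD :: 'b monoid) (BC :: 'b monoid) f.
         skew_left_brace BD BC \<and> f \<in> X \<rightarrow> carrier BC \<and>
         intertwines X f r (brace_solution BD BC) \<longrightarrow>
         (\<exists>\<phi>. (\<phi> \<in> hom G BC \<and> (\<forall>x \<in> X. f x = \<phi> (\<iota> x)) \<and>
                intertwines (carrier G) \<phi> (brace_solution D G) (brace_solution BD BC)) \<and>
              (\<forall>\<psi>. \<psi> \<in> hom G BC \<and> (\<forall>x \<in> X. f x = \<psi> (\<iota> x)) \<and>
                intertwines (carrier G) \<psi> (brace_solution D G) (brace_solution BD BC) \<longrightarrow>
                (\<forall>g \<in> carrier G. \<psi> g = \<phi> g))))"
proof -
  interpret S: nondegenerate_solution X r by unfold_locales fact+
  have G: "G = S.G" using assms(3) by (simp add: enveloping_group_def)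
  have \<iota>: "\<iota> = S.\<iota>" using assms(4) by (simp add: enveloping_map_def fun_eq_iff)
  have brace: "skew_left_brace S.enveloping_dot G" unfolding G by (rule S.enveloping_brace)
  have inter: "intertwines X \<iota> r (brace_solution S.enveloping_dot G)"
    unfolding G \<iota> by (rule S.enveloping_brace_intertwines)
  have carr: "carrier D = carrier G" if "skew_left_brace D G" for D :: "'a word set monoid"
    using that by (rule skew_left_brace.same_carrier)
  show ?thesis
  proof (intro exI[of _ S.enveloping_dot] conjI allI impI; (elim conjE)?)
    show "skew_left_brace S.enveloping_dot G" by (rule brace)
    show "intertwines X \<iota> r (brace_solution S.enveloping_dot G)" by (rule inter)
  next
    fix D' :: "'a word set monoid"
    assume D': "skew_left_brace D' G" "intertwines X \<iota> r (brace_solution D' G)"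
    \<comment> \<open>Uniqueness: the identity of \<open>G\<close> extends \<open>\<iota>\<close>, hence is additive between the two brace structures.\<close>
    have "(\<lambda>g. g) \<in> hom D' S.enveloping_dot"
      by (rule S.intertwining_hom_is_brace_hom[of D' S.enveloping_dot G \<iota>])
        (use D' brace inter in \<open>simp_all add: G \<iota> hom_def\<close>)
    then show "\<forall>a \<in> carrier G. \<forall>b \<in> carrier G. a \<otimes>\<^bsub>D'\<^esub> b = a \<otimes>\<^bsub>S.enveloping_dot\<^esub> b"
      using carr[OF D'(1)] by (auto simp: hom_def)
  next
    fix BD BC :: "'b monoid" and f
    assume B: "skew_left_brace BD BC" and f: "f \<in> X \<rightarrow> carrier BC"
      "intertwines X f r (brace_solution BD BC)"
    from S.enveloping_hom_exists[OF B f] obtain \<phi> where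
      \<phi>: "\<phi> \<in> hom G BC" "\<And>x. x \<in> X \<Longrightarrow> \<phi> (\<iota> x) = f x" unfolding G \<iota> by blast
    have "\<phi> \<in> hom S.enveloping_dot BD"
      using S.intertwining_hom_is_brace_hom[OF S.enveloping_brace(1) S.enveloping_brace_intertwines
          B f(2)] \<phi> by (simp add: G \<iota>)
    then have "intertwines (carrier G) \<phi> (brace_solution S.enveloping_dot G) (brace_solution BD BC)"
      by (rule intertwines_brace_solutions[OF brace B \<phi>(1)])
    moreover have "\<psi> g = \<phi> g" if "\<psi> \<in> hom G BC" "\<forall>x \<in> X. f x = \<psi> (\<iota> x)" "g \<in> carrier G" for \<psi> g
    proof -
      have "group BC" using B by (simp add: skew_left_brace_def)
      then show ?thesis
        using presented_group_hom_unique[of BC \<psi> X "enveloping_relations X r" \<phi> g] that \<phi>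
        by (simp add: G \<iota>)
    qed
    ultimately show "\<exists>\<phi>. (\<phi> \<in> hom G BC \<and> (\<forall>x \<in> X. f x = \<phi> (\<iota> x)) \<and>
          intertwines (carrier G) \<phi> (brace_solution S.enveloping_dot G) (brace_solution BD BC)) \<and>
        (\<forall>\<psi>. \<psi> \<in> hom G BC \<and> (\<forall>x \<in> X. f x = \<psi> (\<iota> x)) \<and>
          intertwines (carrier G) \<psi> (brace_solution S.enveloping_dot G) (brace_solution BD BC) \<longrightarrow>
          (\<forall>g \<in> carrier G. \<psi> g = \<phi> g))"
      using \<phi>(1) \<phi>(2)[symmetric] by blast
  qed
qed

end
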